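(* Consider a continuous first-price or all-pay auction with $N\ge2$ buyers, in quantile coordinates, with canonical equilibrium bidding strategy $\beta$. Let $M\ge1$ and let $\Lambda$ be a set of bidding profiles $\lambda=(\lambda_i)_{i\in[N]}$, $\lambda_i:[0,1]\to B$, such that every $\lambda\in\Lambda$ is symmetric ($\lambda_i=\lambda_j$ for all $i,j$), each $\lambda_i$ is weakly increasing and continuously differentiable on $(0,1]$, and $\lambda_i(\theta)\le M v(\theta)$ for all $\theta\in[0,1]$. Then the constant function $\epsilon(\theta_i)=1$ together with $\gamma=0$ is a feasible solution, of value $0$, of the infinite linear program $$\inf_{\epsilon\ge0,\ \gamma\in\mathbb{R}}\ \gamma\quad\text{s.t.}\quad \gamma+\sum_{i\in[N]}\int_0^1 d\theta_i\,\frac{\epsilon(\theta_i)}{v(\theta_i)}\left(U_i(\beta,\lambda_{-i}|\theta_i)-U_i(\lambda|\theta_i)\right)\ \ge\ \sum_{i\in[N]}\int_0^1 d\theta_i\,\alpha(\theta_i|\lambda)\quad\forall\,\lambda\in\Lambda,$$ whenever $v$ is strictly increasing and differentiable on $[0,1]$: 1. for the all-pay auction, with $$\alpha(\theta_i|\lambda)=\frac{\lambda_i(\theta_i)-\beta(\theta_i)}{v(\theta_i)}-\int_{\beta(\theta_i)}^{\min\{\lambda_i(\theta_i),\beta(1)\}}d\mu\cdot\frac{\theta_i^{N-2}}{\beta^{-1}(\mu)^{N-2}\,v(\beta^{-1}(\mu))};$$ 2. and, if $v$ is also strictly convex, for the first-price auction, with $$\alpha(\theta_i|\lambda)=\theta_i^{N-2}\left(\frac{\theta_i}{v(\theta_i)}\left(\lambda_i(\theta_i)-\beta(\theta_i)\right)-\int_{\beta(\theta_i)}^{\min\{\lambda_i(\theta_i),\beta(1)\}}d\mu\cdot\frac{\beta^{-1}(\mu)}{v(\beta^{-1}(\mu))}\right).$$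 As a consequence, for such prior distributions, any continuous Bayesian coarse correlated equilibrium $\sigma$ on $\Lambda$ for which $$\int_\Lambda d\sigma(\lambda)\sum_{i\in[N]}\int_0^1 d\theta_i\,\frac{\epsilon(\theta_i)}{v(\theta_i)}\left(U_i(\beta,\lambda_{-i}|\theta_i)-U_i(\lambda|\theta_i)\right)=\sum_{i\in[N]}\int_0^1 d\theta_i\,\frac{\epsilon(\theta_i)}{v(\theta_i)}\int_\Lambda d\sigma(\lambda)\left(U_i(\beta,\lambda_{-i}|\theta_i)-U_i(\lambda|\theta_i)\right)$$ holds (with $\epsilon\equiv1$) places probability $1$ on the equilibrium bidding strategies $\beta$.
   Context: Continuous auction in quantile coordinates. There are $N\ge2$ buyers with i.i.d. valuations drawn from a c.d.f. $F$ with a probability density of full support on the interval $V=[0,v(1)]\subset\mathbb{R}_+$; bids lie in an interval $B=[0,\max B]\supseteq V$. Set $v=F^{-1}:[0,1]\to V$, assumed continuous and strictly increasing on $[0,1]$ (so $v(0)=0$) and $C^\infty$ on $(0,1]$. Types $\theta_i$ are i.i.d. uniform on $[0,1]$, and a buyer of type $\theta_i$ has valuation $v(\theta_i)$. A bidding strategy of buyer $i$ is $\lambda_i:[0,1]\to B$, and $\lambda(\theta)=(\lambda_i(\theta_i))_i$. Allocation (uniform tie-breaking): $x_i(b)=1/|\arg\max_j b_j|$ if $i\in\arg\max_j b_j$, and $x_i(b)=0$ otherwise. First-price utility: $u_i(b|w)=x_i(b)(w-b_i)$; all-pay utility: $u_i(b|w)=x_i(b)w-b_i$, for valuation $w$.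 Expected utilities: $U_i(\lambda|\theta_i)=\int_{[0,1]^{N-1}}d\theta_{-i}\,u_i(\lambda(\theta)|v(\theta_i))$; $U_i(b',\lambda_{-i}|\theta_i)$ is the same with buyer $i$'s bid replaced by the constant $b'$; and $U_i(\beta,\lambda_{-i}|\theta_i):=U_i(\beta(\theta_i),\lambda_{-i}|\theta_i)$. Canonical equilibrium: for the first-price auction $\beta(0)=0$ and $\beta(\theta)=\frac{1}{\theta^{N-1}}\int_0^\theta (N-1)t^{N-2}v(t)\,dt$ for $\theta\in(0,1]$; for the all-pay auction $\beta(\theta)=\int_0^\theta (N-1)t^{N-2}v(t)\,dt$. A continuous Bayesian coarse correlated equilibrium (BCCE) with support in $\Lambda$, where $\Lambda$ carries a topology for which $(\lambda,\theta_i,b'_i)\mapsto U_i(b'_i,\lambda_{-i}|\theta_i)-U_i(\lambda|\theta_i)$ is measurable on $\Lambda\times[0,1]\times B$, is a Borel probability measure $\sigma$ on $\Lambda$ such that for all $i\in[N]$, $\theta_i\in[0,1]$, $b'_i\in B$: $\int_\Lambda d\sigma(\lambda)\left(U_i(b'_i,\lambda_{-i}|\theta_i)-U_i(\lambda|\theta_i)\right)\le0$. *)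

theory Defs
  imports "HOL-Probability.Probability"
begin

section \<open>Prior distribution in quantile coordinates\<close>

definition full_support_cdf :: "real \<Rightarrow> (real \<Rightarrow> real) \<Rightarrow> bool" where
  "full_support_cdf vmax F \<longleftrightarrow>
     (\<exists>f :: real \<Rightarrow> real.
        f \<in> borel_measurable borel \<and> (\<forall>x. 0 \<le> f x) \<and> (\<forall>x. x \<notin> {0..vmax} \<longrightarrow> f x = 0) \<and>
        prob_space (density lborel (\<lambda>x. ennreal (f x))) \<and>
        (\<forall>a b. 0 \<le> a \<longrightarrow> a < b \<longrightarrow> b \<le> vmax \<longrightarrow>
           0 < measure (density lborel (\<lambda>x. ennreal (f x))) {a<..<b}) \<and>
        F = cdf (density lborel (\<lambda>x. ennreal (f x))))"

text \<open>
  Derivatives relative to \<open>S\<close>: at an endpoint belonging to \<open>S\<close> they are one-sided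
  (\<open>C1_differentiable_on\<close> of the library would use two-sided derivatives there).
\<close>

definition C1_within :: "real set \<Rightarrow> (real \<Rightarrow> real) \<Rightarrow> bool" where
  "C1_within S f \<longleftrightarrow>
     (\<exists>f'. continuous_on S f' \<and> (\<forall>x\<in>S. (f has_real_derivative f' x) (at x within S)))"

definition Cinf_within :: "real set \<Rightarrow> (real \<Rightarrow> real) \<Rightarrow> bool" where
  "Cinf_within S f \<longleftrightarrow>
     (\<exists>D :: nat \<Rightarrow> real \<Rightarrow> real. (\<forall>x\<in>S. D 0 x = f x) \<and>
        (\<forall>k. \<forall>x\<in>S. (D k has_real_derivative D (Suc k) x) (at x within S)))"

definition strictly_convex_on :: "real set \<Rightarrow> (real \<Rightarrow> real) \<Rightarrow> bool" where
  "strictly_convex_on S f \<longleftrightarrow>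
     (\<forall>x\<in>S. \<forall>y\<in>S. \<forall>t. x \<noteq> y \<longrightarrow> 0 < t \<longrightarrow> t < 1 \<longrightarrow>
        f ((1 - t) * x + t * y) < (1 - t) * f x + t * f y)"

definition quantile_prior :: "(real \<Rightarrow> real) \<Rightarrow> (real \<Rightarrow> real) \<Rightarrow> bool" where
  "quantile_prior F v \<longleftrightarrow>
     full_support_cdf (v 1) F \<and>
     (\<forall>\<theta>\<in>{0..1}. v \<theta> = the_inv_into {0..v 1} F \<theta>) \<and>
     continuous_on {0..1} v \<and> strict_mono_on {0..1} v \<and> Cinf_within {0<..1} v"


section \<open>Auctions and interim expected utilities\<close>

text \<open>
  Buyers are the elements of \<open>{..<N}\<close>; a bid vector is a function on buyers, of which only the
  values on \<open>{..<N}\<close> matter.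
\<close>

datatype auction_format = First_Price | All_Pay

type_synonym profile = "nat \<Rightarrow> real \<Rightarrow> real"

definition highest_bidders :: "nat \<Rightarrow> (nat \<Rightarrow> real) \<Rightarrow> nat set" where
  "highest_bidders N b = {i. is_arg_max b (\<lambda>j. j < N) i}"

definition allocation :: "nat \<Rightarrow> (nat \<Rightarrow> real) \<Rightarrow> nat \<Rightarrow> real" where
  "allocation N b i =
     (if i \<in> highest_bidders N b then 1 / real (card (highest_bidders N b)) else 0)"

fun utility :: "auction_format \<Rightarrow> nat \<Rightarrow> nat \<Rightarrow> (nat \<Rightarrow> real) \<Rightarrow> real \<Rightarrow> real" where
  "utility First_Price N i b w = allocation N b i * (w - b i)"
| "utility All_Pay N i b w = allocation N b i * w - b i"

abbreviation unif01 :: "real measure" where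
  "unif01 \<equiv> restrict_space lborel {0..1}"

abbreviation others_types :: "nat \<Rightarrow> nat \<Rightarrow> (nat \<Rightarrow> real) measure" where
  "others_types N i \<equiv> Pi\<^sub>M ({..<N} - {i}) (\<lambda>_. unif01)"

text \<open>\<open>U\<^sub>i(\<lambda>|\<theta>\<^sub>i)\<close> and \<open>U\<^sub>i(b', \<lambda>\<^sub>-\<^sub>i|\<theta>\<^sub>i)\<close>, where \<open>\<theta>\<close> is the type of buyer \<open>i\<close>.\<close>

definition exp_utility ::
  "auction_format \<Rightarrow> nat \<Rightarrow> (real \<Rightarrow> real) \<Rightarrow> profile \<Rightarrow> nat \<Rightarrow> real \<Rightarrow> real" where
  "exp_utility fmt N v l i \<theta> =
     (\<integral>t. utility fmt N i (\<lambda>j. l j ((t(i := \<theta>)) j)) (v \<theta>) \<partial>others_types N i)"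

definition dev_utility ::
  "auction_format \<Rightarrow> nat \<Rightarrow> (real \<Rightarrow> real) \<Rightarrow> real \<Rightarrow> profile \<Rightarrow> nat \<Rightarrow> real \<Rightarrow> real" where
  "dev_utility fmt N v b' l i \<theta> =
     (\<integral>t. utility fmt N i ((\<lambda>j. l j (t j))(i := b')) (v \<theta>) \<partial>others_types N i)"

fun canonical_bid :: "auction_format \<Rightarrow> nat \<Rightarrow> (real \<Rightarrow> real) \<Rightarrow> real \<Rightarrow> real" where
  "canonical_bid First_Price N v \<theta> =
     (if \<theta> = 0 then 0
      else 1 / \<theta> ^ (N - 1) * (LBINT t=0..\<theta>. real (N - 1) * t ^ (N - 2) * v t))"
| "canonical_bid All_Pay N v \<theta> = (LBINT t=0..\<theta>. real (N - 1) * t ^ (N - 2) * v t)"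

definition canonical_gain ::
  "auction_format \<Rightarrow> nat \<Rightarrow> (real \<Rightarrow> real) \<Rightarrow> profile \<Rightarrow> nat \<Rightarrow> real \<Rightarrow> real" where
  "canonical_gain fmt N v l i \<theta> =
     dev_utility fmt N v (canonical_bid fmt N v \<theta>) l i \<theta> - exp_utility fmt N v l i \<theta>"

text \<open>
  Profiles are extensional functions, so that two profiles are equal as elements of a set
  \<open>\<Lambda>\<close> iff they agree for all buyers and all types in \<open>[0, 1]\<close>.
\<close>

definition symmetric_C1_profiles :: "nat \<Rightarrow> (real \<Rightarrow> real) \<Rightarrow> real \<Rightarrow> real \<Rightarrow> profile set" where
  "symmetric_C1_profiles N v bmax M =
     {l \<in> {..<N} \<rightarrow>\<^sub>E ({0..1} \<rightarrow>\<^sub>E {0..bmax}).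
        (\<forall>i<N. \<forall>j<N. l i = l j) \<and>
        (\<forall>i<N. mono_on {0..1} (l i) \<and> C1_within {0<..1} (l i) \<and>
               (\<forall>\<theta>\<in>{0..1}. l i \<theta> \<le> M * v \<theta>))}"


section \<open>The infinite linear program\<close>

text \<open>
  Interval integrals are oriented, so the integral below is negative if
  \<open>l i \<theta> < canonical_bid fmt N v \<theta>\<close>. Quotients with denominator \<open>v 0 = 0\<close> only affect null
  sets of integration variables.
\<close>

fun alpha :: "auction_format \<Rightarrow> nat \<Rightarrow> (real \<Rightarrow> real) \<Rightarrow> profile \<Rightarrow> nat \<Rightarrow> real \<Rightarrow> real" where
  "alpha All_Pay N v l i \<theta> =
     (let \<beta> = canonical_bid All_Pay N v; \<beta>inv = inv_into {0..1} \<beta> in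
      (l i \<theta> - \<beta> \<theta>) / v \<theta>
      - (LBINT \<mu>=\<beta> \<theta>..min (l i \<theta>) (\<beta> 1). \<theta> ^ (N - 2) / (\<beta>inv \<mu> ^ (N - 2) * v (\<beta>inv \<mu>))))"
| "alpha First_Price N v l i \<theta> =
     (let \<beta> = canonical_bid First_Price N v; \<beta>inv = inv_into {0..1} \<beta> in
      \<theta> ^ (N - 2) *
        (\<theta> / v \<theta> * (l i \<theta> - \<beta> \<theta>)
         - (LBINT \<mu>=\<beta> \<theta>..min (l i \<theta>) (\<beta> 1). \<beta>inv \<mu> / v (\<beta>inv \<mu>))))"

text \<open>
  Feasibility includes that the integrals in the constraint exist; otherwise the
  integral operator would silently return 0.
\<close>

definition lp_feasible ::
  "auction_format \<Rightarrow> nat \<Rightarrow> (real \<Rightarrow> real) \<Rightarrow> profile set \<Rightarrow> (profile \<Rightarrow> nat \<Rightarrow> real \<Rightarrow> real) \<Rightarrow>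
    (real \<Rightarrow> real) \<Rightarrow> real \<Rightarrow> bool" where
  "lp_feasible fmt N v \<Lambda> \<alpha> \<epsilon> \<gamma> \<longleftrightarrow>
     (\<forall>\<theta>\<in>{0..1}. 0 \<le> \<epsilon> \<theta>) \<and>
     (\<forall>l\<in>\<Lambda>.
        (\<forall>i<N. integrable unif01 (\<lambda>\<theta>. \<epsilon> \<theta> / v \<theta> * canonical_gain fmt N v l i \<theta>) \<and>
               integrable unif01 (\<alpha> l i)) \<and>
        \<gamma> + (\<Sum>i<N. \<integral>\<theta>. \<epsilon> \<theta> / v \<theta> * canonical_gain fmt N v l i \<theta> \<partial>unif01)
          \<ge> (\<Sum>i<N. \<integral>\<theta>. \<alpha> l i \<theta> \<partial>unif01))"

definition lp_objective :: "(real \<Rightarrow> real) \<Rightarrow> real \<Rightarrow> real" where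
  "lp_objective \<epsilon> \<gamma> = \<gamma>"


section \<open>Continuous Bayesian coarse correlated equilibria\<close>

definition borel_of_topology :: "'a topology \<Rightarrow> 'a measure" where
  "borel_of_topology T = sigma (topspace T) {U. openin T U}"

text \<open>
  Since \<open>[0, 1] \<times> [0, bmax]\<close> is second countable, the product \<open>\<sigma>\<close>-algebra below is the Borel
  \<open>\<sigma>\<close>-algebra of the product topology, whatever the topology \<open>T\<close> on the set of profiles.
\<close>

definition deviation_measurable ::
  "auction_format \<Rightarrow> nat \<Rightarrow> (real \<Rightarrow> real) \<Rightarrow> real \<Rightarrow> profile topology \<Rightarrow> bool" where
  "deviation_measurable fmt N v bmax T \<longleftrightarrow>
     (\<forall>i<N. (\<lambda>(l, \<theta>, b'). dev_utility fmt N v b' l i \<theta> - exp_utility fmt N v l i \<theta>)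
        \<in> borel_measurable
            (borel_of_topology T \<Otimes>\<^sub>M
              (restrict_space borel {0..1} \<Otimes>\<^sub>M restrict_space borel {0..bmax})))"

definition continuous_BCCE ::
  "auction_format \<Rightarrow> nat \<Rightarrow> (real \<Rightarrow> real) \<Rightarrow> real \<Rightarrow> profile topology \<Rightarrow> profile measure \<Rightarrow> bool" where
  "continuous_BCCE fmt N v bmax T \<sigma> \<longleftrightarrow>
     deviation_measurable fmt N v bmax T \<and>
     prob_space \<sigma> \<and> sets \<sigma> = sets (borel_of_topology T) \<and>
     (\<forall>i<N. \<forall>\<theta>\<in>{0..1}. \<forall>b'\<in>{0..bmax}.
        (\<integral>l. dev_utility fmt N v b' l i \<theta> - exp_utility fmt N v l i \<theta> \<partial>\<sigma>) \<le> 0)"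

definition interchange_condition ::
  "auction_format \<Rightarrow> nat \<Rightarrow> (real \<Rightarrow> real) \<Rightarrow> profile measure \<Rightarrow> (real \<Rightarrow> real) \<Rightarrow> bool" where
  "interchange_condition fmt N v \<sigma> \<epsilon> \<longleftrightarrow>
     (\<integral>l. (\<Sum>i<N. \<integral>\<theta>. \<epsilon> \<theta> / v \<theta> * canonical_gain fmt N v l i \<theta> \<partial>unif01) \<partial>\<sigma>)
     = (\<Sum>i<N. \<integral>\<theta>. \<epsilon> \<theta> / v \<theta> * (\<integral>l. canonical_gain fmt N v l i \<theta> \<partial>\<sigma>) \<partial>unif01)"

end

theory Submission
  imports Defs
begin

text \<open>
  Let \<open>\<phi>(\<theta>) = \<beta>\<^sup>-\<^sup>1(min {\<lambda>(\<theta>), \<beta>(1)})\<close>. A deviation to \<open>\<beta>(\<theta>)\<close> wins with probability at least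
  \<open>\<bar>{\<phi> < \<theta>}\<bar>^(N - 1)\<close>, so by Fubini its total value is at least an integral over \<open>\<phi>\<close>, which the
  substitution \<open>\<mu> = \<beta>(s)\<close> identifies with the integral in \<open>\<alpha>\<close>. The winning probabilities under \<open>\<lambda>\<close>
  have total mass one, and in the first-price auction the payments relative to \<open>v\<close> are at least those
  of the allocation to the highest type: ties only shift weight to types with larger \<open>1/v\<close>.
  Hence the constraint holds. Since the factor integrated in \<open>\<alpha>\<close> decreases strictly in the type, \<open>\<alpha>\<close>
  is nonnegative and vanishes only where \<open>\<lambda> = \<beta>\<close>. Averaging the constraint over an equilibrium \<open>\<sigma>\<close>
  leaves a nonnegative function with nonpositive integral, which vanishes exactly at \<open>\<beta>\<close>.
\<close>

text \<open>Dividing the gain by \<open>v\<close> makes the winning term of \<lambda> independent of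
  \<lambda>: summed over the buyers it is the probability 1 that the object is sold. The winning
  term of the deviation meets \<alpha> through one identity: \<open>weight\<close> times the
  derivative of \<beta> is N - 1 times the value of a win at \<beta>(\<theta>), relative to
  \<open>v\<close> and net of the payment that winning triggers. This factor N - 1 is the one in the
  density (N - 1) s^(N - 2) of the highest of the N - 1 rival types, which Fubini brings in. The
  part of \<alpha> free of \<lambda> integrates, up to payments due without winning, to 1 / N per
  buyer, and over all buyers this cancels against the probability 1. The obstacle is the type 0,
  where \<open>v\<close> vanishes and \<open>weight\<close> may be unbounded: the product of
  \<open>weight\<close> and the derivative of \<beta> stays bounded, and \<lambda> \<le> M v bounds
  the payments.\<close>

section \<open>Allocations and winning probabilities\<close>

lemma highest_bidders_eq: "highest_bidders N b = {i. i < N \<and> (\<forall>j<N. b j \<le> b i)}"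
  by (auto simp: highest_bidders_def is_arg_max_linorder)

lemma finite_highest_bidders: "finite (highest_bidders N b)"
  by (simp add: highest_bidders_eq)

lemma highest_bidders_nonempty:
  assumes "0 < N" shows "highest_bidders N b \<noteq> {}"
proof -
  have "Max (b ` {..<N}) \<in> b ` {..<N}"
    using assms by (intro Max_in) auto
  then obtain i where "i < N" "b i = Max (b ` {..<N})"
    by auto
  then have "i \<in> highest_bidders N b"
    by (auto simp: highest_bidders_eq)
  then show ?thesis by blast
qed

lemma allocation_nonneg: "0 \<le> allocation N b i"
  by (simp add: allocation_def)

lemma allocation_eq_0: "i \<notin> highest_bidders N b \<Longrightarrow> allocation N b i = 0"
  by (simp add: allocation_def)

lemma allocation_le_1: "allocation N b i \<le> 1"
  by (auto simp: allocation_def divide_simps intro!: Suc_leI)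

lemma sum_allocation:
  assumes "0 < N" shows "(\<Sum>i<N. allocation N b i) = 1"
proof -
  let ?H = "highest_bidders N b"
  have "(\<Sum>i<N. allocation N b i) = (\<Sum>i\<in>?H. allocation N b i)"
    by (rule sum.mono_neutral_right) (auto simp: highest_bidders_eq allocation_def)
  also have "\<dots> = (\<Sum>i\<in>?H. 1 / real (card ?H))"
    by (intro sum.cong) (simp_all add: allocation_def)
  finally show ?thesis
    using highest_bidders_nonempty[OF assms] finite_highest_bidders by simp
qed

lemma allocation_cong:
  assumes "\<And>j. j < N \<Longrightarrow> b j = b' j" shows "allocation N b i = allocation N b' i"
proof -
  have "highest_bidders N b = highest_bidders N b'"
    using assms by (auto simp: highest_bidders_eq)
  then show ?thesis by (simp add: allocation_def)
qed

lemma allocation_unique_highest: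
  assumes "i < N" "\<And>j. j < N \<Longrightarrow> j \<noteq> i \<Longrightarrow> b j < b i"
  shows "allocation N b i = 1"
proof -
  have "highest_bidders N b = {i}"
    using assms by (force simp: highest_bidders_eq not_less[symmetric])
  then show ?thesis by (simp add: allocation_def)
qed

text \<open>The cardinality becomes a finite sum of conditions on bids, each of which is measurable.
  This is the form that \<open>measurable_allocation\<close> works with.\<close>

lemma allocation_eq_sum:
  assumes "i < N"
  shows "allocation N b i =
    (if \<forall>j<N. b j \<le> b i then 1 / (\<Sum>j<N. if \<forall>k<N. b k \<le> b j then 1 else 0) else 0)"
proof -
  have "(\<Sum>j<N. if \<forall>k<N. b k \<le> b j then 1 else 0 :: real) = real (card (highest_bidders N b))"
    by (simp add: highest_bidders_eq flip: sum.inter_filter)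
  moreover have "i \<in> highest_bidders N b \<longleftrightarrow> (\<forall>j<N. b j \<le> b i)"
    using assms by (simp add: highest_bidders_eq)
  ultimately show ?thesis by (simp only: allocation_def)
qed

lemma measurable_allocation:
  assumes "i < N" "\<And>j. j < N \<Longrightarrow> (\<lambda>x. b x j) \<in> borel_measurable A"
  shows "(\<lambda>x. allocation N (b x) i) \<in> borel_measurable A"
proof -
  have pred: "{x \<in> space A. \<forall>k<N. b x k \<le> b x j} \<in> sets A" if "j < N" for j
  proof -
    have "{x \<in> space A. \<forall>k\<in>{..<N}. b x k \<le> b x j} \<in> sets A"
      using assms(2) that by (intro sets.sets_Collect_finite_All' borel_measurable_le) auto
    then show ?thesis unfolding Ball_def lessThan_iff .
  qed
  have "(\<lambda>x. \<Sum>j<N. if \<forall>k<N. b x k \<le> b x j then 1 else 0 :: real) \<in> borel_measurable A"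
  proof (rule borel_measurable_sum)
    fix j assume "j \<in> {..<N}"
    then show "(\<lambda>x. if \<forall>k<N. b x k \<le> b x j then 1 else 0 :: real) \<in> borel_measurable A"
      by (intro measurable_If[OF borel_measurable_const borel_measurable_const pred])
        (rule lessThan_iff[THEN iffD1])
  qed
  then show ?thesis
    unfolding allocation_eq_sum[OF assms(1)]
    by (rule measurable_If[OF borel_measurable_divide[OF borel_measurable_const]
          borel_measurable_const pred[OF assms(1)]])
qed

text \<open>
  Among tied bids, the bidder of highest type carries the smallest weight, and without ties
  only that bidder counts.
\<close>

lemma sum_allocation_weighted_le:
  fixes h :: "real \<Rightarrow> real"
  assumes "0 < N" and mono: "mono_on A f" and t: "\<And>j. j < N \<Longrightarrow> t j \<in> A"
    and h: "\<And>r s. r \<in> A \<Longrightarrow> s \<in> A \<Longrightarrow> r \<le> s \<Longrightarrow> f r = f s \<Longrightarrow> h s \<le> h r"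
  shows "(\<Sum>i<N. allocation N t i * h (t i)) \<le> (\<Sum>i<N. allocation N (\<lambda>j. f (t j)) i * h (t i))"
proof -
  obtain m where m: "m < N" "\<And>j. j < N \<Longrightarrow> t j \<le> t m"
    using highest_bidders_nonempty[OF assms(1), of t] by (auto simp: highest_bidders_eq)
  have "allocation N t i * h (t i) = allocation N t i * h (t m)" if "i < N" for i
  proof (cases "i \<in> highest_bidders N t")
    case True
    then have "t i = t m" using m that by (auto simp: highest_bidders_eq intro: antisym)
    then show ?thesis by simp
  qed (simp add: allocation_eq_0)
  then have "(\<Sum>i<N. allocation N t i * h (t i)) = (\<Sum>i<N. allocation N t i * h (t m))"
    by (intro sum.cong) auto
  \<comment> \<open>Both allocations have total mass 1, so against the constant
    \<open>h (t m)\<close> one can replace the other.\<close>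
  also have "\<dots> = (\<Sum>i<N. allocation N (\<lambda>j. f (t j)) i * h (t m))"
    by (simp add: sum_allocation[OF assms(1)] flip: sum_distrib_right)
  also have "\<dots> \<le> (\<Sum>i<N. allocation N (\<lambda>j. f (t j)) i * h (t i))"
  proof (intro sum_mono)
    fix i assume i: "i \<in> {..<N}"
    show "allocation N (\<lambda>j. f (t j)) i * h (t m) \<le> allocation N (\<lambda>j. f (t j)) i * h (t i)"
    proof (cases "i \<in> highest_bidders N (\<lambda>j. f (t j))")
      case True
      \<comment> \<open>A winner \<open>i\<close> bids at least as much as \<open>m\<close>, and by
        monotonicity at most as much. So \<open>i\<close> and \<open>m\<close> are tied, which is
        the case covered by the hypothesis on \<open>h\<close>.\<close>
      then have "f (t m) \<le> f (t i)" using m by (auto simp: highest_bidders_eq)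
      moreover have "f (t i) \<le> f (t m)" using m i t by (intro mono_onD[OF mono]) auto
      ultimately have "h (t m) \<le> h (t i)" using m i t by (intro h) auto
      then show ?thesis by (simp add: allocation_nonneg mult_left_mono)
    qed (simp add: allocation_eq_0)
  qed
  finally show ?thesis .
qed

text \<open>Profiles are symmetric, so a single strategy \<open>f\<close> describes all rivals. Both
  utilities are affine in the allocation, hence this is the only integral over the rivals' types
  that has to be studied.\<close>

definition win_prob :: "nat \<Rightarrow> (real \<Rightarrow> real) \<Rightarrow> nat \<Rightarrow> real \<Rightarrow> real" where
  "win_prob N f i b = (\<integral>t. allocation N ((\<lambda>j. f (t j))(i := b)) i \<partial>others_types N i)"

lemma space_unif01 [simp]: "space unif01 = {0..1}"
  by (simp add: space_restrict_space)

lemma sets_unif01: "sets unif01 = sets (restrict_space borel {0..1})"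
  by (rule sets_restrict_space_cong) simp

lemma prob_space_unif01: "prob_space unif01"
  by (rule prob_spaceI) (simp add: emeasure_restrict_space)

lemma measure_unif01_less:
  assumes "x \<in> {0..1}" shows "measure unif01 {s \<in> {0..1}. s < x} = x"
proof -
  have "measure unif01 {0..<x} = x"
    using assms by (subst measure_restrict_space) auto
  moreover have "{s \<in> {0..1}. s < x} = {0..<x}" using assms by auto
  ultimately show ?thesis by simp
qed

lemma product_prob_space_unif01: "product_prob_space (\<lambda>_. unif01)"
  by (simp add: product_prob_space_def product_sigma_finite_def prob_space_unif01
      product_prob_space_axioms_def prob_space_imp_sigma_finite)

lemma prob_space_others_types: "prob_space (others_types N i)"
  by (rule prob_space_PiM) (rule prob_space_unif01)

lemma mono_on_measurable_unif01:
  fixes f :: "real \<Rightarrow> real"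
  assumes "mono_on {0..1} f" shows "f \<in> borel_measurable unif01"
  using borel_measurable_mono_on_fnc[OF assms] by (subst measurable_cong_sets[OF sets_unif01 refl])

lemma measurable_profile_bids:
  assumes "f \<in> borel_measurable unif01" "j \<in> I"
  shows "(\<lambda>t. f (t j)) \<in> borel_measurable (Pi\<^sub>M I (\<lambda>_. unif01))"
  using measurable_compose[OF measurable_component_singleton[OF assms(2)] assms(1)] .

text \<open>Joint measurability in the bid and the types is needed because the bid will itself be a
  function of the own type, over which a second integral runs.\<close>

lemma measurable_allocation_others:
  assumes "i < N" "f \<in> borel_measurable unif01"
  shows "(\<lambda>(b, t). allocation N ((\<lambda>j. f (t j))(i := b)) i)
    \<in> borel_measurable (borel \<Otimes>\<^sub>M others_types N i)"
  unfolding case_prod_unfold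
proof (rule measurable_allocation[OF assms(1)])
  fix j assume "j < N"
  show "(\<lambda>x. ((\<lambda>j. f (snd x j))(i := fst x)) j) \<in> borel_measurable (borel \<Otimes>\<^sub>M others_types N i)"
  proof (cases "j = i")
    case False
    then show ?thesis
      using \<open>j < N\<close> measurable_compose[OF measurable_snd
          measurable_profile_bids[OF assms(2), of j "{..<N} - {i}"], of borel] by simp
  qed simp
qed

lemma integrable_allocation_others:
  assumes "i < N" "f \<in> borel_measurable unif01"
  shows "integrable (others_types N i) (\<lambda>t. allocation N ((\<lambda>j. f (t j))(i := b)) i)"
proof -
  interpret prob_space "others_types N i" by (rule prob_space_others_types)
  have "(\<lambda>t. allocation N ((\<lambda>j. f (t j))(i := b)) i) \<in> borel_measurable (others_types N i)"
    using measurable_Pair2[OF measurable_allocation_others[OF assms], of b] by simp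
  then show ?thesis
    by (intro integrable_const_bound[where B = 1]) (auto simp: allocation_nonneg allocation_le_1)
qed

lemma measurable_win_prob:
  assumes "i < N" "f \<in> borel_measurable unif01"
  shows "win_prob N f i \<in> borel_measurable borel"
proof -
  interpret prob_space "others_types N i" by (rule prob_space_others_types)
  show ?thesis
    unfolding win_prob_def[abs_def]
    using borel_measurable_lebesgue_integral[OF measurable_allocation_others[OF assms]] by simp
qed

lemma win_prob_nonneg: "0 \<le> win_prob N f i b"
  unfolding win_prob_def by (intro integral_nonneg_AE) (simp add: allocation_nonneg)

lemma win_prob_le_1:
  assumes "i < N" "f \<in> borel_measurable unif01" shows "win_prob N f i b \<le> 1"
proof -
  interpret prob_space "others_types N i" by (rule prob_space_others_types)
  show ?thesis
    unfolding win_prob_def using integrable_allocation_others[OF assms]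
    by (intro integral_le_const) (auto simp: allocation_le_1)
qed

text \<open>If all N - 1 rivals bid strictly less than \<open>b\<close>, the buyer wins outright,
  and by independence this has the stated probability. Wins in ties are discarded, which is harmless
  since only a lower bound on the deviation's value is wanted.\<close>

lemma win_prob_ge_power:
  assumes "i < N" "f \<in> borel_measurable unif01"
  shows "measure unif01 {s \<in> {0..1}. f s < b} ^ (N - 1) \<le> win_prob N f i b"
proof -
  interpret PP: product_prob_space "\<lambda>_. unif01" "{..<N} - {i}" by (rule product_prob_space_unif01)
  interpret PF: finite_product_prob_space "\<lambda>_. unif01" "{..<N} - {i}" by unfold_locales simp
  interpret prob_space "others_types N i" by (rule prob_space_others_types)
  let ?S = "{s \<in> {0..1}. f s < b}" and ?J = "{..<N} - {i}"
  have S: "?S \<in> sets unif01" using measurable_sets[OF assms(2), of "{..<b}"] by (simp add: vimage_def Int_def conj_commute)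
  have E: "Pi\<^sub>E ?J (\<lambda>_. ?S) \<in> sets (others_types N i)"
    using S by (intro sets_PiM_I_finite) auto
  have "measure unif01 ?S ^ (N - 1) = measure (others_types N i) (Pi\<^sub>E ?J (\<lambda>_. ?S))"
    using S assms(1) by (subst PF.finite_measure_PiM_emb) auto
  also have "\<dots> = (\<integral>t. indicator (Pi\<^sub>E ?J (\<lambda>_. ?S)) t \<partial>others_types N i)"
    using E by simp
  also have "\<dots> \<le> (\<integral>t. allocation N ((\<lambda>j. f (t j))(i := b)) i \<partial>others_types N i)"
  proof (rule integral_mono)
    fix t assume "t \<in> space (others_types N i)"
    show "indicator (Pi\<^sub>E ?J (\<lambda>_. ?S)) t \<le> allocation N ((\<lambda>j. f (t j))(i := b)) i"
    proof (cases "t \<in> Pi\<^sub>E ?J (\<lambda>_. ?S)")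
      case True
      have "f (t j) < b" if "j < N" "j \<noteq> i" for j
        using PiE_mem[OF True, of j] that by simp
      then have "allocation N ((\<lambda>j. f (t j))(i := b)) i = 1"
        using assms(1) by (intro allocation_unique_highest) auto
      then show ?thesis by (simp add: indicator_le_1)
    qed (simp add: allocation_nonneg)
  qed (use E integrable_allocation_others[OF assms] in \<open>auto intro: integrable_real_indicator simp: less_top[symmetric]\<close>)
  finally show ?thesis by (simp add: win_prob_def)
qed

text \<open>Integrating the interim winning probability over the own type restores the full type
  vector. This passage from interim to ex ante quantities lets allocations be compared pointwise,
  for each type vector.\<close>

lemma sum_integral_win_prob:
  assumes f: "f \<in> borel_measurable unif01" and h: "h \<in> borel_measurable unif01"
    and h_bound: "\<And>s. s \<in> {0..1} \<Longrightarrow> \<bar>h s\<bar> \<le> K"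
  shows "(\<Sum>i<N. \<integral>\<theta>. win_prob N f i (f \<theta>) * h \<theta> \<partial>unif01)
    = (\<integral>t. (\<Sum>i<N. allocation N (\<lambda>j. f (t j)) i * h (t i)) \<partial>Pi\<^sub>M {..<N} (\<lambda>_. unif01))"
    and "i < N \<Longrightarrow> integrable (Pi\<^sub>M {..<N} (\<lambda>_. unif01)) (\<lambda>t. allocation N (\<lambda>j. f (t j)) i * h (t i))"
proof -
  interpret PP: product_prob_space "\<lambda>_. unif01" by (rule product_prob_space_unif01)
  interpret Q: prob_space "Pi\<^sub>M {..<N} (\<lambda>_. unif01)"
    by (rule prob_space_PiM) (rule prob_space_unif01)
  show int: "integrable (Pi\<^sub>M {..<N} (\<lambda>_. unif01)) (\<lambda>t. allocation N (\<lambda>j. f (t j)) i * h (t i))"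
    if i: "i < N" for i
  proof (rule Q.integrable_const_bound[where B = K])
    show "(\<lambda>t. allocation N (\<lambda>j. f (t j)) i * h (t i)) \<in> borel_measurable (Pi\<^sub>M {..<N} (\<lambda>_. unif01))"
      using i by (intro borel_measurable_times measurable_allocation measurable_profile_bids f h) auto
    show "AE t in Pi\<^sub>M {..<N} (\<lambda>_. unif01). norm (allocation N (\<lambda>j. f (t j)) i * h (t i)) \<le> K"
    proof (rule AE_I2)
      fix t assume "t \<in> space (Pi\<^sub>M {..<N} (\<lambda>_. unif01))"
      then have "\<bar>h (t i)\<bar> \<le> K" using i by (intro h_bound) (auto simp: space_PiM dest!: PiE_mem)
      then show "norm (allocation N (\<lambda>j. f (t j)) i * h (t i)) \<le> K"
        using mult_mono[OF allocation_le_1[of N "\<lambda>j. f (t j)" i] \<open>\<bar>h (t i)\<bar> \<le> K\<close>]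
        by (simp add: abs_mult allocation_nonneg)
    qed
  qed
  have "(\<integral>\<theta>. win_prob N f i (f \<theta>) * h \<theta> \<partial>unif01)
    = (\<integral>t. allocation N (\<lambda>j. f (t j)) i * h (t i) \<partial>Pi\<^sub>M {..<N} (\<lambda>_. unif01))" if i: "i < N" for i
  proof -
    let ?J = "{..<N} - {i}"
    have J: "insert i ?J = {..<N}" and notin: "i \<notin> ?J" using i by auto
    have "(\<integral>t. allocation N (\<lambda>j. f (t j)) i * h (t i) \<partial>Pi\<^sub>M (insert i ?J) (\<lambda>_. unif01))
      = (\<integral>\<theta>. \<integral>t. allocation N (\<lambda>j. f ((t(i := \<theta>)) j)) i * h ((t(i := \<theta>)) i) \<partial>Pi\<^sub>M ?J (\<lambda>_. unif01) \<partial>unif01)"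
    proof -
      interpret J: prob_space "Pi\<^sub>M ?J (\<lambda>_. unif01)"
        by (rule prob_space_PiM) (rule prob_space_unif01)
      interpret pair_prob_space "Pi\<^sub>M ?J (\<lambda>_. unif01)" unif01
        by unfold_locales
      let ?g = "\<lambda>t \<theta>. allocation N (\<lambda>j. f ((t(i := \<theta>)) j)) i * h ((t(i := \<theta>)) i)"
      \<comment> \<open>\<open>product_integral_insert\<close> leaves the own type innermost, while
        \<open>win_prob\<close> integrates the rivals first. Integrability on the pair space permits
        the exchange.\<close>
      have *: "integrable (Pi\<^sub>M ?J (\<lambda>_. unif01) \<Otimes>\<^sub>M unif01) (\<lambda>(t, \<theta>). ?g t \<theta>)"
      proof (rule P.integrable_const_bound[where B = K])
        have "(\<lambda>(t, \<theta>). t(i := \<theta>)) \<in> Pi\<^sub>M ?J (\<lambda>_. unif01) \<Otimes>\<^sub>M unif01 \<rightarrow>\<^sub>M Pi\<^sub>M {..<N} (\<lambda>_. unif01)"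
          using measurable_add_dim[of i ?J "\<lambda>_. unif01"] unfolding J .
        from measurable_compose[OF this borel_measurable_integrable[OF int[OF i]]]
        show "(\<lambda>(t, \<theta>). ?g t \<theta>) \<in> borel_measurable (Pi\<^sub>M ?J (\<lambda>_. unif01) \<Otimes>\<^sub>M unif01)"
          by (simp add: case_prod_unfold)
        show "AE x in Pi\<^sub>M ?J (\<lambda>_. unif01) \<Otimes>\<^sub>M unif01. norm (case x of (t, \<theta>) \<Rightarrow> ?g t \<theta>) \<le> K"
        proof (rule AE_I2)
          fix x assume "x \<in> space (Pi\<^sub>M ?J (\<lambda>_. unif01) \<Otimes>\<^sub>M unif01)"
          then have "\<bar>h (snd x)\<bar> \<le> K" by (intro h_bound) (auto simp: space_pair_measure)
          then show "norm (case x of (t, \<theta>) \<Rightarrow> ?g t \<theta>) \<le> K"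
            using mult_mono[OF allocation_le_1 \<open>\<bar>h (snd x)\<bar> \<le> K\<close>]
            by (simp add: abs_mult allocation_nonneg case_prod_unfold)
        qed
      qed
      have int_i: "integrable (Pi\<^sub>M (insert i ?J) (\<lambda>_. unif01))
          (\<lambda>t. allocation N (\<lambda>j. f (t j)) i * h (t i))"
        unfolding J by (rule int[OF i])
      from Fubini_integral[OF *] show ?thesis
        unfolding PP.product_integral_insert[OF finite_Diff[OF finite_lessThan] notin
            int_i] by (rule sym)
    qed
    also have "\<dots> = (\<integral>\<theta>. win_prob N f i (f \<theta>) * h \<theta> \<partial>unif01)"
      by (simp add: win_prob_def fun_upd_def if_distrib cong: if_cong)
    finally show ?thesis unfolding J by simp
  qed
  then show "(\<Sum>i<N. \<integral>\<theta>. win_prob N f i (f \<theta>) * h \<theta> \<partial>unif01)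
    = (\<integral>t. (\<Sum>i<N. allocation N (\<lambda>j. f (t j)) i * h (t i)) \<partial>Pi\<^sub>M {..<N} (\<lambda>_. unif01))"
    using int by simp
qed

text \<open>The object is always sold: for each type vector the allocations add up to 1.\<close>

lemma sum_integral_win_prob_eq_1:
  assumes "0 < N" "f \<in> borel_measurable unif01"
  shows "(\<Sum>i<N. \<integral>\<theta>. win_prob N f i (f \<theta>) \<partial>unif01) = 1"
proof -
  interpret P: prob_space "Pi\<^sub>M {..<N} (\<lambda>_. unif01)"
    by (rule prob_space_PiM) (rule prob_space_unif01)
  show ?thesis
    using sum_integral_win_prob(1)[OF assms(2), of "\<lambda>_. 1" 1 N]
    by (simp add: sum_allocation[OF assms(1)] P.prob_space)
qed

text \<open>The left side is a lower bound for the allocation to the highest type, realised by the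
  strategy \<open>\<lambda>x. x\<close>. Written ex ante, it is compared with the allocation under
  \<open>f\<close> by \<open>sum_allocation_weighted_le\<close>, and the result is read back as
  interim integrals.\<close>

lemma sum_integral_win_prob_weighted_ge:
  assumes "0 < N" "mono_on {0..1} f"
    and "h \<in> borel_measurable unif01" "\<And>s. s \<in> {0..1} \<Longrightarrow> 0 \<le> h s \<and> h s \<le> K"
    and h: "\<And>r s. r \<in> {0..1} \<Longrightarrow> s \<in> {0..1} \<Longrightarrow> r \<le> s \<Longrightarrow> f r = f s \<Longrightarrow> h s \<le> h r"
  shows "real N * (\<integral>\<theta>. \<theta> ^ (N - 1) * h \<theta> \<partial>unif01) \<le> (\<Sum>i<N. \<integral>\<theta>. win_prob N f i (f \<theta>) * h \<theta> \<partial>unif01)"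
proof -
  interpret U: prob_space unif01 by (rule prob_space_unif01)
  have id: "(\<lambda>x. x) \<in> borel_measurable unif01"
    by (rule mono_on_measurable_unif01) (simp add: mono_on_def)
  have f: "f \<in> borel_measurable unif01" using assms(2) by (rule mono_on_measurable_unif01)
  have K: "\<bar>h s\<bar> \<le> K" if "s \<in> {0..1}" for s using assms(4)[OF that] by auto
  have "(\<integral>\<theta>. \<theta> ^ (N - 1) * h \<theta> \<partial>unif01) \<le> (\<integral>\<theta>. win_prob N (\<lambda>x. x) i \<theta> * h \<theta> \<partial>unif01)"
    if i: "i < N" for i
  proof (rule integral_mono_AE')
    show "integrable unif01 (\<lambda>\<theta>. win_prob N (\<lambda>x. x) i \<theta> * h \<theta>)"
    proof (rule U.integrable_const_bound[where B = K])
      show "(\<lambda>\<theta>. win_prob N (\<lambda>x. x) i \<theta> * h \<theta>) \<in> borel_measurable unif01"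
        using measurable_compose[OF id measurable_win_prob[OF i id]] assms(3) by auto
      show "AE \<theta> in unif01. norm (win_prob N (\<lambda>x. x) i \<theta> * h \<theta>) \<le> K"
      proof (rule AE_I2)
        fix \<theta> assume "\<theta> \<in> space unif01"
        then show "norm (win_prob N (\<lambda>x. x) i \<theta> * h \<theta>) \<le> K"
          using mult_mono[OF win_prob_le_1[OF i id, of \<theta>] K] by (simp add: abs_mult win_prob_nonneg)
      qed
    qed
    show "AE \<theta> in unif01. \<theta> ^ (N - 1) * h \<theta> \<le> win_prob N (\<lambda>x. x) i \<theta> * h \<theta>"
    proof (rule AE_I2)
      fix \<theta> assume \<theta>: "\<theta> \<in> space unif01"
      then have "\<theta> ^ (N - 1) \<le> win_prob N (\<lambda>x. x) i \<theta>"
        using win_prob_ge_power[OF i id, of \<theta>] by (simp only: space_unif01 measure_unif01_less)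
      then show "\<theta> ^ (N - 1) * h \<theta> \<le> win_prob N (\<lambda>x. x) i \<theta> * h \<theta>"
        using \<theta> assms(4) by (intro mult_right_mono) auto
    qed
    show "AE \<theta> in unif01. 0 \<le> win_prob N (\<lambda>x. x) i \<theta> * h \<theta>"
      using assms(4) by (intro AE_I2) (auto simp: win_prob_nonneg)
  qed
  then have "real N * (\<integral>\<theta>. \<theta> ^ (N - 1) * h \<theta> \<partial>unif01)
    \<le> (\<Sum>i<N. \<integral>\<theta>. win_prob N (\<lambda>x. x) i \<theta> * h \<theta> \<partial>unif01)"
    using sum_mono[of "{..<N}" "\<lambda>_. \<integral>\<theta>. \<theta> ^ (N - 1) * h \<theta> \<partial>unif01"] by simp
  also have "\<dots> = (\<integral>t. (\<Sum>i<N. allocation N t i * h (t i)) \<partial>Pi\<^sub>M {..<N} (\<lambda>_. unif01))"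
    using sum_integral_win_prob(1)[OF id assms(3) K, of N] by simp
  also have "\<dots> \<le> (\<integral>t. (\<Sum>i<N. allocation N (\<lambda>j. f (t j)) i * h (t i)) \<partial>Pi\<^sub>M {..<N} (\<lambda>_. unif01))"
    using sum_integral_win_prob(2)[OF id assms(3) K] sum_integral_win_prob(2)[OF f assms(3) K]
    by (intro integral_mono Bochner_Integration.integrable_sum sum_allocation_weighted_le[OF assms(1,2) _ h])
       (auto simp: space_PiM dest!: PiE_mem)
  also have "\<dots> = (\<Sum>i<N. \<integral>\<theta>. win_prob N f i (f \<theta>) * h \<theta> \<partial>unif01)"
    using sum_integral_win_prob(1)[OF f assms(3) K, of N] by simp
  finally show ?thesis .
qed

section \<open>Interim utilities and gains in terms of winning probabilities\<close>

lemma dev_utility_eq: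
  assumes i: "i < N" and l: "\<And>j. j < N \<Longrightarrow> l j = f" and f: "f \<in> borel_measurable unif01"
  shows "dev_utility First_Price N v b l i \<theta> = win_prob N f i b * (v \<theta> - b)"
    and "dev_utility All_Pay N v b l i \<theta> = win_prob N f i b * v \<theta> - b"
proof -
  interpret prob_space "others_types N i" by (rule prob_space_others_types)
  have eq: "allocation N ((\<lambda>j. l j (t j))(i := b)) i = allocation N ((\<lambda>j. f (t j))(i := b)) i" for t
    using l by (intro allocation_cong) auto
  show "dev_utility First_Price N v b l i \<theta> = win_prob N f i b * (v \<theta> - b)"
    by (simp add: dev_utility_def eq win_prob_def)
  show "dev_utility All_Pay N v b l i \<theta> = win_prob N f i b * v \<theta> - b"
    using integrable_allocation_others[OF i f, of b]
    by (simp add: dev_utility_def eq win_prob_def prob_space)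
qed

lemma exp_utility_eq_dev_utility:
  "exp_utility fmt N v l i \<theta> = dev_utility fmt N v (l i \<theta>) l i \<theta>"
proof -
  have "(\<lambda>j. l j ((t(i := \<theta>)) j)) = (\<lambda>j. l j (t j))(i := l i \<theta>)" for t by auto
  then show ?thesis by (simp add: exp_utility_def dev_utility_def)
qed

lemma canonical_gain_eq:
  assumes "i < N" "\<And>j. j < N \<Longrightarrow> l j = f" "f \<in> borel_measurable unif01"
  shows "canonical_gain First_Price N v l i \<theta> =
      (let b = canonical_bid First_Price N v \<theta> in
        win_prob N f i b * (v \<theta> - b) - win_prob N f i (f \<theta>) * (v \<theta> - f \<theta>))"
    and "canonical_gain All_Pay N v l i \<theta> =
      (let b = canonical_bid All_Pay N v \<theta> in
        (win_prob N f i b - win_prob N f i (f \<theta>)) * v \<theta> + (f \<theta> - b))"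
  using assms(1,2) unfolding canonical_gain_def exp_utility_eq_dev_utility
  by (simp_all add: dev_utility_eq[OF assms] Let_def algebra_simps del: canonical_bid.simps)

section \<open>Integration over a uniform type and exchange of integrals\<close>

lemma ident_measurable_unif01: "(\<lambda>x. x) \<in> borel_measurable unif01"
  by (rule mono_on_measurable_unif01) (simp add: mono_on_def)

lemma sets_unif01_subset: "A \<in> sets borel \<Longrightarrow> A \<subseteq> {0..1} \<Longrightarrow> A \<in> sets unif01"
  by (auto simp: sets_restrict_space_iff)

lemma AE_unif01_neq: "AE s in unif01. s \<noteq> x"
proof (cases "x \<in> {0..1}")
  case True
  then have "{x} \<in> null_sets unif01"
    by (intro null_setsI) (auto simp: emeasure_restrict_space intro: sets_unif01_subset)
  then show ?thesis by (rule AE_I') auto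
qed (auto intro: AE_I2)

lemma integrable_unif01_bounded:
  assumes "f \<in> borel_measurable unif01" "\<And>s. s \<in> {0..1} \<Longrightarrow> \<bar>f s\<bar> \<le> K"
  shows "integrable unif01 (f :: real \<Rightarrow> real)"
proof -
  interpret prob_space unif01 by (rule prob_space_unif01)
  show ?thesis using assms by (intro integrable_const_bound[where B = K]) auto
qed

lemma integral_unif01:
  "(\<integral>x. f x \<partial>unif01) = (\<integral>x. indicator {0..1} x * f x \<partial>lborel)" for f :: "real \<Rightarrow> real"
  by (simp add: integral_restrict_space)

text \<open>Up to the single point \<open>Sup S\<close>, a nonempty initial segment is
  \<open>{0..g}\<close> with \<open>g = Sup S\<close>. Its measure is \<open>g\<close>, and the
  power of \<open>g\<close> is the integral of its derivative.\<close>

lemma measure_power_initial_segment: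
  assumes S: "S \<in> sets unif01" and down: "\<And>r s. s \<in> S \<Longrightarrow> 0 \<le> r \<Longrightarrow> r \<le> s \<Longrightarrow> r \<in> S"
  shows "measure unif01 S ^ Suc n = (\<integral>s. indicator S s * (real (Suc n) * s ^ n) \<partial>unif01)"
proof (cases "S = {}")
  case False
  define g where "g = Sup S"
  have sub: "S \<subseteq> {0..1}" using sets.sets_into_space[OF S] by simp
  then have bdd: "bdd_above S" by (meson bdd_above_Icc bdd_above_mono)
  have le: "s \<le> g" if "s \<in> S" for s unfolding g_def using bdd that by (rule cSup_upper[rotated])
  have g: "g \<in> {0..1}"
  proof -
    have "g \<le> 1" unfolding g_def using False sub by (intro cSup_least) auto
    moreover obtain s where "s \<in> S" using False by blast
    ultimately show ?thesis using le[of s] sub by force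
  qed
  have mem: "s \<in> S" if "0 \<le> s" "s < g" for s
  proof -
    obtain r where "r \<in> S" "s < r"
      using \<open>s < g\<close> unfolding g_def less_cSup_iff[OF False bdd] by blast
    then show ?thesis using down[of r s] that by auto
  qed
  have G: "{0..g} \<in> sets unif01" using g by (intro sets_unif01_subset) auto
  have AE: "AE s in unif01. s \<in> S \<longleftrightarrow> s \<in> {0..g}"
    using AE_unif01_neq[of g] AE_space
  proof eventually_elim
    case (elim s) then show ?case using le[of s] mem[of s] by auto
  qed
  have "measure unif01 S = measure unif01 {0..g}"
    using AE S G by (rule measure_eq_AE)
  also have "\<dots> = g"
    using g by (subst measure_restrict_space) auto
  finally have "measure unif01 S ^ Suc n = g ^ Suc n" by simp
  also have "\<dots> = (\<integral>s. real (Suc n) * (s ^ n * indicator {0..g} s) \<partial>lborel)"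
    using integral_power[of 0 g n] g by simp
  also have "\<dots> = (\<integral>s. indicator {0..g} s * (real (Suc n) * s ^ n) \<partial>unif01)"
    using g unfolding integral_unif01
    by (intro Bochner_Integration.integral_cong) (auto split: split_indicator)
  also have "\<dots> = (\<integral>s. indicator S s * (real (Suc n) * s ^ n) \<partial>unif01)"
  proof (rule integral_cong_AE)
    have [measurable]: "(\<lambda>x. x) \<in> borel_measurable unif01" by (rule ident_measurable_unif01)
    show "(\<lambda>s. indicator {0..g} s * (real (Suc n) * s ^ n)) \<in> borel_measurable unif01"
      "(\<lambda>s. indicator S s * (real (Suc n) * s ^ n)) \<in> borel_measurable unif01"
      using S G by (auto intro!: borel_measurable_times borel_measurable_power)
    show "AE s in unif01. indicator {0..g} s * (real (Suc n) * s ^ n) =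
        indicator S s * (real (Suc n) * s ^ n)"
      using AE by eventually_elim (simp add: indicator_def)
  qed
  finally show ?thesis .
qed simp

text \<open>Monotonicity of \<open>\<phi>\<close> makes each set on the left an initial segment, so
  its power is the integral of a density. Fubini then turns the condition \<phi>(s) < \<theta> into
  a tail integral of \<open>q\<close> starting at \<open>\<phi> s\<close>.\<close>

lemma integral_measure_power_weighted:
  fixes \<phi> q :: "real \<Rightarrow> real"
  assumes mono: "mono_on {0..1} \<phi>"
    and q: "q \<in> borel_measurable unif01" "\<And>s. s \<in> {0..1} \<Longrightarrow> \<bar>q s\<bar> \<le> K"
  shows "(\<integral>\<theta>. measure unif01 {s \<in> {0..1}. \<phi> s < \<theta>} ^ Suc n * q \<theta> \<partial>unif01)
    = (\<integral>s. real (Suc n) * s ^ n * (\<integral>\<theta>. indicator {\<phi> s<..} \<theta> * q \<theta> \<partial>unif01) \<partial>unif01)"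
proof -
  interpret U: prob_space unif01 by (rule prob_space_unif01)
  interpret pair_prob_space unif01 unif01 by unfold_locales
  define k where "k s \<theta> = real (Suc n) * s ^ n * (indicator {\<phi> s<..} \<theta> * q \<theta>)" for s \<theta> :: real
  have \<phi>: "\<phi> \<in> borel_measurable unif01" using mono by (rule mono_on_measurable_unif01)
  have k_meas: "(\<lambda>x. k (fst x) (snd x)) \<in> borel_measurable (unif01 \<Otimes>\<^sub>M unif01)"
  proof -
    note 1 = measurable_compose[OF measurable_fst \<phi>, of unif01]
      measurable_compose[OF measurable_fst ident_measurable_unif01, of unif01]
      measurable_compose[OF measurable_snd q(1), of unif01]
      measurable_compose[OF measurable_snd ident_measurable_unif01, of unif01]
    have "(\<lambda>x. if \<phi> (fst x) < snd x then real (Suc n) * fst x ^ n * q (snd x) else 0)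
        \<in> borel_measurable (unif01 \<Otimes>\<^sub>M unif01)"
      using 1 by (intro measurable_If borel_measurable_times borel_measurable_power
          borel_measurable_const borel_measurable_less)
    also have "?this \<longleftrightarrow> ?thesis"
      by (rule measurable_cong) (simp add: k_def)
    finally show ?thesis .
  qed
  have k_bound: "\<bar>k s \<theta>\<bar> \<le> real (Suc n) * K" if "s \<in> {0..1}" "\<theta> \<in> {0..1}" for s \<theta>
  proof -
    have "0 \<le> K" using q(2)[of 0] by auto
    have "\<bar>s ^ n * q \<theta>\<bar> \<le> 1 * K"
      unfolding abs_mult using that q(2)[of \<theta>] by (intro mult_mono) (auto simp: power_abs power_le_one)
    then have "real (Suc n) * \<bar>s ^ n * q \<theta>\<bar> \<le> real (Suc n) * K" by (intro mult_left_mono) auto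
    then show ?thesis using \<open>0 \<le> K\<close> by (simp add: k_def indicator_def abs_mult mult.assoc)
  qed
  have int: "integrable (unif01 \<Otimes>\<^sub>M unif01) (case_prod k)"
    unfolding case_prod_unfold
    by (rule P.integrable_const_bound[where B = "real (Suc n) * K", OF AE_I2 k_meas])
      (use k_bound in \<open>auto simp: space_pair_measure\<close>)
  have inner: "measure unif01 {s \<in> {0..1}. \<phi> s < \<theta>} ^ Suc n * q \<theta> = (\<integral>s. k s \<theta> \<partial>unif01)"
    if "\<theta> \<in> {0..1}" for \<theta>
  proof -
    let ?S = "{s \<in> {0..1}. \<phi> s < \<theta>}"
    have S: "?S \<in> sets unif01"
      using measurable_sets[OF \<phi>, of "{..<\<theta>}"] by (simp add: vimage_def Int_def conj_commute)
    have "measure unif01 ?S ^ Suc n = (\<integral>s. indicator ?S s * (real (Suc n) * s ^ n) \<partial>unif01)"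
      using S
    proof (rule measure_power_initial_segment)
      fix r s assume "s \<in> ?S" "0 \<le> r" "r \<le> s"
      then show "r \<in> ?S" using mono_onD[OF mono, of r s] by auto
    qed
    also have "\<dots> * q \<theta> = (\<integral>s. indicator ?S s * (real (Suc n) * s ^ n) * q \<theta> \<partial>unif01)"
      by simp
    also have "\<dots> = (\<integral>s. k s \<theta> \<partial>unif01)"
      by (intro Bochner_Integration.integral_cong) (auto simp: k_def indicator_def)
    finally show ?thesis by simp
  qed
  have "(\<integral>\<theta>. measure unif01 {s \<in> {0..1}. \<phi> s < \<theta>} ^ Suc n * q \<theta> \<partial>unif01)
      = (\<integral>\<theta>. \<integral>s. k s \<theta> \<partial>unif01 \<partial>unif01)"
    by (intro Bochner_Integration.integral_cong refl inner) auto
  also have "\<dots> = (\<integral>s. \<integral>\<theta>. k s \<theta> \<partial>unif01 \<partial>unif01)"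
    by (rule Fubini_integral[OF int])
  also have "\<dots> = (\<integral>s. real (Suc n) * s ^ n * (\<integral>\<theta>. indicator {\<phi> s<..} \<theta> * q \<theta> \<partial>unif01) \<partial>unif01)"
    by (simp add: k_def)
  finally show ?thesis .
qed

section \<open>Canonical bids\<close>

text \<open>A prior with a density supported on nonnegative values has \<open>F 0 = 0\<close>, and
  full support makes \<open>F\<close> injective on \<open>{0..v 1}\<close>, so the inverse returns 0
  at 0.\<close>

lemma quantile_prior_0:
  assumes "quantile_prior F v" shows "v 0 = 0"
proof -
  obtain f where f: "f \<in> borel_measurable borel" "\<And>x. x \<notin> {0..v 1} \<Longrightarrow> f x = (0::real)"
    and prob: "prob_space (density lborel (\<lambda>x. ennreal (f x)))"
    and pos: "\<And>a b. 0 \<le> a \<Longrightarrow> a < b \<Longrightarrow> b \<le> v 1 \<Longrightarrow>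
        0 < measure (density lborel (\<lambda>x. ennreal (f x))) {a<..<b}"
    and F: "F = cdf (density lborel (\<lambda>x. ennreal (f x)))"
    using assms unfolding quantile_prior_def full_support_cdf_def by blast
  let ?D = "density lborel (\<lambda>x. ennreal (f x))"
  interpret D: prob_space ?D by (rule prob)
  have null: "measure ?D {..0} = 0"
  proof -
    have "AE x in lborel. ennreal (f x) * indicator {..0} x = 0"
      using AE_lborel_singleton[of 0] by eventually_elim (auto simp: f(2) indicator_def)
    then have "emeasure ?D {..0} = (\<integral>\<^sup>+x. 0 \<partial>(lborel :: real measure))"
      using f(1) by (subst emeasure_density) (simp, simp, rule nn_integral_cong_AE)
    then show ?thesis by (simp add: measure_def)
  qed
  have "strict_mono_on {0..v 1} F"
  proof (rule strict_mono_onI)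
    fix a b assume ab: "a \<in> {0..v 1}" "b \<in> {0..v 1}" "a < b"
    then have "0 < measure ?D {a<..<b}" by (intro pos) auto
    also have "\<dots> \<le> measure ?D ({..b} - {..a})"
      by (intro D.finite_measure_mono) auto
    also have "\<dots> = measure ?D {..b} - measure ?D {..a}"
      using ab by (intro D.finite_measure_Diff) auto
    finally show "F a < F b" by (simp add: F cdf_def)
  qed
  then have inj: "inj_on F {0..v 1}" by (rule strict_mono_on_imp_inj_on)
  \<comment> \<open>Otherwise \<open>{0..v 1}\<close> is empty and the density vanishes everywhere,
    which contradicts total mass 1.\<close>
  have "0 \<le> v 1"
  proof (rule ccontr)
    assume "\<not> 0 \<le> v 1"
    then have "emeasure ?D UNIV = 0" using f by (subst emeasure_density) auto
    then show False using D.emeasure_space_1 by simp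
  qed
  moreover have "F 0 = 0" using null by (simp add: F cdf_def)
  ultimately have "the_inv_into {0..v 1} F 0 = 0"
    using the_inv_into_f_f[OF inj, of 0] by simp
  moreover have "v 0 = the_inv_into {0..v 1} F 0"
    using assms unfolding quantile_prior_def by (metis atLeastAtMost_iff order_refl zero_le_one)
  ultimately show ?thesis by simp
qed

locale quantile_auction =
  fixes N :: nat and v :: "real \<Rightarrow> real"
  assumes N: "2 \<le> N" and v_0 [simp]: "v 0 = 0"
    and v_cont: "continuous_on {0..1} v" and v_mono: "strict_mono_on {0..1} v"
begin

lemma v_less: "0 \<le> a \<Longrightarrow> a < b \<Longrightarrow> b \<le> 1 \<Longrightarrow> v a < v b"
  using strict_mono_onD[OF v_mono, of a b] by auto

lemma v_pos: "0 < x \<Longrightarrow> x \<le> 1 \<Longrightarrow> 0 < v x"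
  using v_less[of 0 x] by simp

lemma v_nonneg: "0 \<le> x \<Longrightarrow> x \<le> 1 \<Longrightarrow> 0 \<le> v x"
  using v_pos[of x] by (cases "x = 0") auto

section \<open>Canonical bids of the all-pay auction\<close>

abbreviation ap_bid :: "real \<Rightarrow> real" where
  "ap_bid \<equiv> canonical_bid All_Pay N v"

lemma ap_bid_0: "ap_bid 0 = 0"
  by (simp add: zero_ereal_def[symmetric])

lemma ap_bid_deriv:
  assumes "x \<in> {0..1}"
  shows "(ap_bid has_real_derivative real (N - 1) * x ^ (N - 2) * v x) (at x within {0..1})"
proof -
  have "continuous_on {0..1} (\<lambda>t. real (N - 1) * t ^ (N - 2) * v t)"
    by (intro continuous_intros v_cont)
  from interval_integral_FTC2[OF order_refl zero_le_one this, of x] show ?thesis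
    using assms unfolding has_real_derivative_iff_has_vector_derivative canonical_bid.simps zero_ereal_def
    by simp
qed

lemma ap_bid_deriv_at:
  assumes "0 < x" "x < 1"
  shows "(ap_bid has_real_derivative real (N - 1) * x ^ (N - 2) * v x) (at x)"
proof -
  have "at x within {0..1} = at x" using assms by (intro at_within_interior) simp
  then show ?thesis using ap_bid_deriv[of x] assms by (simp del: canonical_bid.simps)
qed

lemma ap_bid_cont: "continuous_on {0..1} ap_bid"
  using ap_bid_deriv by (rule DERIV_continuous_on)

lemma power_deriv: "((\<lambda>t. t ^ (N - 1) * c) has_real_derivative real (N - 1) * x ^ (N - 2) * c) (at x)"
proof -
  have "N - 1 - Suc 0 = N - 2" by simp
  then show ?thesis by (auto intro!: derivative_eq_intros)
qed

text \<open>Freezing the valuation at its largest value \<open>v x\<close> turns the integral that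
  defines the bid into the right side. The difference of the two starts at 0 and decreases
  strictly.\<close>

lemma ap_bid_less:
  assumes "0 < x" "x \<le> 1" shows "ap_bid x < x ^ (N - 1) * v x"
proof -
  let ?g = "\<lambda>t. ap_bid t - t ^ (N - 1) * v x"
  have "?g x < ?g 0"
  proof (rule DERIV_neg_imp_decreasing_open[OF assms(1)])
    fix t assume t: "0 < t" "t < x"
    have "real (N - 1) * t ^ (N - 2) * v t < real (N - 1) * t ^ (N - 2) * v x"
      using t assms N by (intro mult_strict_left_mono v_less) auto
    then have less: "real (N - 1) * t ^ (N - 2) * v t - real (N - 1) * t ^ (N - 2) * v x < 0"
      by (simp only: diff_less_0_iff_less)
    have "(?g has_real_derivative
        real (N - 1) * t ^ (N - 2) * v t - real (N - 1) * t ^ (N - 2) * v x) (at t)"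
      using t assms by (intro DERIV_diff ap_bid_deriv_at power_deriv) auto
    then show "\<exists>y. DERIV ?g t :> y \<and> y < 0" using less by blast
  qed (use assms in \<open>intro continuous_intros continuous_on_subset[OF ap_bid_cont]; auto\<close>)
  then show ?thesis using N ap_bid_0 by (simp add: power_0_left)
qed

lemma ap_bid_strict_mono: "strict_mono_on {0..1} ap_bid"
proof (rule strict_mono_onI)
  fix a b :: real assume ab: "a \<in> {0..1}" "b \<in> {0..1}" "a < b"
  show "ap_bid a < ap_bid b"
  proof (rule DERIV_pos_imp_increasing_open[OF ab(3)])
    fix t assume t: "a < t" "t < b"
    then have "0 < real (N - 1) * t ^ (N - 2) * v t" using ab N by (intro mult_pos_pos v_pos) auto
    moreover have "DERIV ap_bid t :> real (N - 1) * t ^ (N - 2) * v t"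
      using t ab by (intro ap_bid_deriv_at) auto
    ultimately show "\<exists>y. DERIV ap_bid t :> y \<and> 0 < y" by blast
  qed (use ab in \<open>intro continuous_on_subset[OF ap_bid_cont]; auto\<close>)
qed

lemma ap_bid_nonneg: "x \<in> {0..1} \<Longrightarrow> 0 \<le> ap_bid x"
  using strict_mono_on_leD[OF ap_bid_strict_mono, of 0 x] ap_bid_0 by auto

section \<open>Canonical bids of the first-price auction\<close>

abbreviation fp_bid :: "real \<Rightarrow> real" where
  "fp_bid \<equiv> canonical_bid First_Price N v"

lemma fp_bid_0: "fp_bid 0 = 0" by simp

lemma fp_bid_pos_eq: "x \<noteq> 0 \<Longrightarrow> fp_bid x = ap_bid x / x ^ (N - 1)" by simp

lemma fp_bid_less_v: assumes "0 < x" "x \<le> 1" shows "fp_bid x < v x"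
  using ap_bid_less[OF assms] assms
  by (simp add: fp_bid_pos_eq divide_simps mult.commute del: canonical_bid.simps)

lemma fp_bid_nonneg: "x \<in> {0..1} \<Longrightarrow> 0 \<le> fp_bid x"
  using ap_bid_nonneg[of x] fp_bid_0
  by (cases "x = 0") (auto simp: fp_bid_pos_eq simp del: canonical_bid.simps)

text \<open>This is the first-order condition of the first-price equilibrium, obtained from the
  quotient rule. The definition branches at 0, so the derivative of the quotient is transferred on
  the open unit interval.\<close>

lemma fp_bid_deriv:
  assumes "0 < x" "x < 1"
  shows "(fp_bid has_real_derivative real (N - 1) * (v x - fp_bid x) / x) (at x)"
proof -
  obtain n where n: "N = Suc (Suc n)" using N by (metis add_2_eq_Suc le_Suc_ex)
  have "((\<lambda>t. ap_bid t / t ^ (N - 1)) has_real_derivative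
      (real (N - 1) * x ^ (N - 2) * v x * x ^ (N - 1) - ap_bid x * (real (N - 1) * x ^ (N - 2) * 1))
        / (x ^ (N - 1) * x ^ (N - 1))) (at x)"
    using assms power_deriv[of 1]
    by (intro DERIV_divide ap_bid_deriv_at) auto
  also have "(real (N - 1) * x ^ (N - 2) * v x * x ^ (N - 1) - ap_bid x * (real (N - 1) * x ^ (N - 2) * 1))
        / (x ^ (N - 1) * x ^ (N - 1)) = real (N - 1) * (v x - fp_bid x) / x"
    using assms unfolding fp_bid_pos_eq[OF less_imp_neq[OF assms(1), symmetric]]
    by (simp add: n field_simps del: canonical_bid.simps)
  finally show ?thesis
    by (rule has_field_derivative_transform_within_open[where S = "{0<..<1}"])
      (use assms in \<open>auto simp: fp_bid_pos_eq simp del: canonical_bid.simps\<close>)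
qed

lemma fp_bid_cont: "continuous_on {0..1} fp_bid"
  unfolding continuous_on_eq_continuous_within
proof
  fix x :: real assume x: "x \<in> {0..1}"
  show "continuous (at x within {0..1}) fp_bid"
  proof (cases "x = 0")
    case True
    \<comment> \<open>At 0 the quotient formula breaks down; there the bid is squeezed between 0 and
      \<open>v\<close>, which tends to 0.\<close>
    have "(v \<longlongrightarrow> v 0) (at 0 within {0..1})"
      using v_cont[unfolded continuous_on_def, rule_format, of 0] by (simp del: v_0)
    then have "(v \<longlongrightarrow> 0) (at 0 within {0..1})" by simp
    then have "(fp_bid \<longlongrightarrow> 0) (at 0 within {0..1})"
    proof (rule tendsto_sandwich[OF _ _ tendsto_const, rotated 2])
      show "\<forall>\<^sub>F x in at 0 within {0..1}. 0 \<le> fp_bid x"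
        unfolding eventually_at_filter using fp_bid_nonneg
        by (intro always_eventually) (auto simp del: canonical_bid.simps)
      show "\<forall>\<^sub>F x in at 0 within {0..1}. fp_bid x \<le> v x"
        unfolding eventually_at_filter using fp_bid_less_v
        by (intro always_eventually) (auto simp: less_imp_le simp del: canonical_bid.simps)
    qed
    then show ?thesis using True fp_bid_0 by (simp add: continuous_within del: canonical_bid.simps)
  next
    case False
    have "continuous (at x within {0..1}) (\<lambda>t. ap_bid t / t ^ (N - 1))"
      using False x ap_bid_cont
      by (intro continuous_intros) (auto simp: continuous_on_eq_continuous_within simp del: canonical_bid.simps)
    moreover have "0 < x" using False x by simp
    ultimately show ?thesis
      by (rule continuous_transform_within[OF _ _ x])
        (auto simp: fp_bid_pos_eq dist_real_def simp del: canonical_bid.simps)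
  qed
qed

lemma fp_bid_strict_mono: "strict_mono_on {0..1} fp_bid"
proof (rule strict_mono_onI)
  fix a b :: real assume ab: "a \<in> {0..1}" "b \<in> {0..1}" "a < b"
  show "fp_bid a < fp_bid b"
  proof (rule DERIV_pos_imp_increasing_open[OF ab(3)])
    fix t assume t: "a < t" "t < b"
    then have "0 < real (N - 1) * (v t - fp_bid t) / t"
      using ab N fp_bid_less_v[of t] by (intro divide_pos_pos mult_pos_pos) auto
    moreover have "DERIV fp_bid t :> real (N - 1) * (v t - fp_bid t) / t"
      using t ab by (intro fp_bid_deriv) auto
    ultimately show "\<exists>y. DERIV fp_bid t :> y \<and> 0 < y" by blast
  qed (use ab in \<open>intro continuous_on_subset[OF fp_bid_cont]; auto\<close>)
qed

end

text \<open>
  Both formats share one shape: up to the factor \<open>\<theta>^(N - 2)\<close>, the integrand of \<open>\<alpha>\<close> is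
  \<open>weight (\<beta>\<^sup>-\<^sup>1(\<mu>))\<close>, and the substitution \<open>\<mu> = \<beta>(s)\<close> turns it into
  \<open>weighted_deriv = weight \<cdot> \<beta>'\<close>.
\<close>

locale quantile_auction_format = quantile_auction +
  fixes fmt :: auction_format
  assumes convex: "fmt = First_Price \<Longrightarrow> strictly_convex_on {0..1} v"
begin

definition bid :: "real \<Rightarrow> real" where
  "bid = canonical_bid fmt N v"

definition bid_deriv :: "real \<Rightarrow> real" where
  "bid_deriv x = (case fmt of First_Price \<Rightarrow> real (N - 1) * (v x - bid x) / x
      | All_Pay \<Rightarrow> real (N - 1) * x ^ (N - 2) * v x)"

definition weight :: "real \<Rightarrow> real" where
  "weight x = (case fmt of First_Price \<Rightarrow> x / v x | All_Pay \<Rightarrow> 1 / (x ^ (N - 2) * v x))"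

text \<open>Divided by N - 1, this is the value of winning with the canonical bid, relative to
  \<open>v x\<close> and net of what only a winner pays. It is bounded even where
  \<open>weight\<close> is not, so integrals are taken of it rather than of
  \<open>weight\<close>.\<close>

definition weighted_deriv :: "real \<Rightarrow> real" where
  "weighted_deriv x = (case fmt of First_Price \<Rightarrow> real (N - 1) * (1 - bid x / v x) | All_Pay \<Rightarrow> real (N - 1))"

lemma bid_0: "bid 0 = 0"
  unfolding bid_def using fp_bid_0 ap_bid_0 by (cases fmt) auto

lemma bid_cont: "continuous_on {0..1} bid"
  unfolding bid_def using fp_bid_cont ap_bid_cont
  by (cases fmt) (auto simp del: canonical_bid.simps)

lemma bid_strict_mono: "strict_mono_on {0..1} bid"
  unfolding bid_def using fp_bid_strict_mono ap_bid_strict_mono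
  by (cases fmt) (auto simp del: canonical_bid.simps)

lemma bid_less: "0 \<le> a \<Longrightarrow> a < b \<Longrightarrow> b \<le> 1 \<Longrightarrow> bid a < bid b"
  using strict_mono_onD[OF bid_strict_mono, of a b] by auto

lemma bid_le: "0 \<le> a \<Longrightarrow> a \<le> b \<Longrightarrow> b \<le> 1 \<Longrightarrow> bid a \<le> bid b"
  using bid_less[of a b] by (cases "a = b") auto

lemma bid_nonneg: "0 \<le> x \<Longrightarrow> x \<le> 1 \<Longrightarrow> 0 \<le> bid x"
  using bid_le[of 0 x] bid_0 by simp

lemma bid_le_v: assumes "0 \<le> x" "x \<le> 1" shows "bid x \<le> v x"
proof (cases "x = 0")
  case False
  then have x: "0 < x" using assms by simp
  show ?thesis
  proof (cases fmt)
    case All_Pay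
    have "ap_bid x < x ^ (N - 1) * v x" using x assms(2) by (rule ap_bid_less)
    also have "\<dots> \<le> 1 * v x" using assms by (intro mult_right_mono power_le_one v_nonneg)
    finally show ?thesis unfolding bid_def by (simp add: All_Pay del: canonical_bid.simps)
  next
    case First_Price
    then show ?thesis
      unfolding bid_def using fp_bid_less_v[OF x assms(2)] by (simp del: canonical_bid.simps)
  qed
qed (simp add: bid_0)

lemma bid_has_deriv: "0 < x \<Longrightarrow> x < 1 \<Longrightarrow> (bid has_real_derivative bid_deriv x) (at x)"
  unfolding bid_def bid_deriv_def using fp_bid_deriv[of x] ap_bid_deriv_at[of x]
  by (cases fmt) (auto simp del: canonical_bid.simps)

lemma bid_deriv_nonneg: "0 \<le> x \<Longrightarrow> x \<le> 1 \<Longrightarrow> 0 \<le> bid_deriv x"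
  unfolding bid_deriv_def using bid_le_v[of x] v_nonneg[of x] by (cases fmt) auto

lemma isCont_v: "0 < x \<Longrightarrow> x < 1 \<Longrightarrow> isCont v x"
  using v_cont by (rule continuous_on_interior) simp

lemma isCont_bid: "0 < x \<Longrightarrow> x < 1 \<Longrightarrow> isCont bid x"
  using bid_cont by (rule continuous_on_interior) simp

lemma isCont_bid_deriv: "0 < x \<Longrightarrow> x < 1 \<Longrightarrow> isCont bid_deriv x"
  unfolding bid_deriv_def[abs_def] using isCont_v isCont_bid
  by (cases fmt) (auto intro!: continuous_intros)

lemma isCont_weight: "0 < x \<Longrightarrow> x < 1 \<Longrightarrow> isCont weight x"
  unfolding weight_def[abs_def] using isCont_v v_pos[of x]
  by (cases fmt) (auto intro!: continuous_intros)

lemma weight_pos: "0 < x \<Longrightarrow> x \<le> 1 \<Longrightarrow> 0 < weight x"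
  unfolding weight_def using v_pos[of x] by (cases fmt) auto

lemma weight_nonneg: "0 \<le> x \<Longrightarrow> x \<le> 1 \<Longrightarrow> 0 \<le> weight x"
  unfolding weight_def using v_nonneg[of x] by (cases fmt) auto

text \<open>In the first-price case this is where strict convexity enters: since
  \<open>v 0 = 0\<close>, the chord from 0 to \<open>b\<close> lies above \<open>v\<close> at
  \<open>a\<close>, so v(x) / x increases strictly. In the all-pay case the denominator is a product
  of increasing factors.\<close>

lemma weight_less:
  assumes "0 < a" "a < b" "b \<le> 1" shows "weight b < weight a"
proof (cases fmt)
  case First_Price
  have "v ((1 - a / b) * 0 + a / b * b) < (1 - a / b) * v 0 + a / b * v b"
    using convex[OF First_Price, unfolded strictly_convex_on_def, rule_format, of 0 b "a / b"] assms
    by simp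
  then have "v a < a / b * v b" using assms by simp
  then show ?thesis
    unfolding weight_def using assms v_pos[of a] v_pos[of b]
    by (simp add: First_Price divide_simps mult.commute)
next
  case All_Pay
  have "a ^ (N - 2) * v a < b ^ (N - 2) * v b"
    using assms v_less[of a b] v_nonneg[of a] by (intro mult_le_less_imp_less power_mono) auto
  moreover have "0 < a ^ (N - 2) * v a" using assms v_pos[of a] by simp
  ultimately show ?thesis unfolding weight_def by (simp add: All_Pay frac_less2)
qed

lemma weighted_deriv_eq: "0 < x \<Longrightarrow> x \<le> 1 \<Longrightarrow> weight x * bid_deriv x = weighted_deriv x"
  unfolding weight_def bid_deriv_def weighted_deriv_def
  using v_pos[of x] by (cases fmt) (auto simp: field_simps)

lemma weighted_deriv_nonneg: "0 \<le> x \<Longrightarrow> x \<le> 1 \<Longrightarrow> 0 \<le> weighted_deriv x"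
  unfolding weighted_deriv_def using bid_le_v[of x] v_nonneg[of x]
  by (cases fmt) (auto intro!: mult_nonneg_nonneg simp: divide_le_eq_1)

lemma weighted_deriv_le: "0 \<le> x \<Longrightarrow> x \<le> 1 \<Longrightarrow> weighted_deriv x \<le> real (N - 1)"
  unfolding weighted_deriv_def using bid_nonneg[of x] v_nonneg[of x]
  by (cases fmt) (auto simp: mult_le_cancel_left2)

lemma abs_weighted_deriv_le: "x \<in> {0..1} \<Longrightarrow> \<bar>weighted_deriv x\<bar> \<le> real (N - 1)"
  using weighted_deriv_le[of x] weighted_deriv_nonneg[of x] by simp

lemma v_measurable: "v \<in> borel_measurable unif01"
  by (intro mono_on_measurable_unif01 strict_mono_on_imp_mono_on v_mono)

lemma bid_measurable: "bid \<in> borel_measurable unif01"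
  by (intro mono_on_measurable_unif01 strict_mono_on_imp_mono_on bid_strict_mono)

lemma weighted_deriv_measurable: "weighted_deriv \<in> borel_measurable unif01"
  unfolding weighted_deriv_def[abs_def] using bid_measurable v_measurable by (cases fmt) auto

end

section \<open>The integral in \<open>\<alpha>\<close>\<close>

lemma set_integrable_const_Ioo: "set_integrable lborel {a<..<b :: real} (\<lambda>_. k :: real)"
proof -
  have "integrable lborel (indicator {a<..<b} :: real \<Rightarrow> real)"
    by (cases "a \<le> b") (auto intro!: integrable_real_indicator)
  then show ?thesis unfolding set_integrable_def by simp
qed

context quantile_auction_format begin

definition bid_inv :: "real \<Rightarrow> real" where
  "bid_inv = inv_into {0..1} bid"

text \<open>This is the inner integral that \<open>integral_measure_power_weighted\<close> produces.
  Its differences are the integrals of \<open>weight (bid_inv \<mu>)\<close> occurring in \<alpha>,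
  so it links the deviation's winning term to \<alpha>.\<close>

definition weight_tail :: "real \<Rightarrow> real" where
  "weight_tail x = (\<integral>\<theta>. indicator {x<..} \<theta> * weighted_deriv \<theta> \<partial>unif01)"

lemma bid_inv_bid: "x \<in> {0..1} \<Longrightarrow> bid_inv (bid x) = x"
  unfolding bid_inv_def by (rule inv_into_f_f[OF strict_mono_on_imp_inj_on[OF bid_strict_mono]])

lemma bid_image: "bid ` {0..1} = {0..bid 1}"
proof
  show "bid ` {0..1} \<subseteq> {0..bid 1}" using bid_nonneg bid_le[of _ 1] by auto
  show "{0..bid 1} \<subseteq> bid ` {0..1}"
  proof
    fix y assume "y \<in> {0..bid 1}"
    then obtain x where "0 \<le> x" "x \<le> 1" "bid x = y"
      using IVT'[of bid 0 y 1] bid_cont bid_0 by auto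
    then show "y \<in> bid ` {0..1}" by auto
  qed
qed

lemma bid_inv_mem: "y \<in> {0..bid 1} \<Longrightarrow> bid_inv y \<in> {0..1}"
  unfolding bid_image[symmetric] bid_inv_def by (rule inv_into_into)

lemma bid_bid_inv: "y \<in> {0..bid 1} \<Longrightarrow> bid (bid_inv y) = y"
  unfolding bid_image[symmetric] bid_inv_def by (rule f_inv_into_f)

lemma bid_less_iff: "x \<in> {0..1} \<Longrightarrow> y \<in> {0..1} \<Longrightarrow> bid x < bid y \<longleftrightarrow> x < y"
  using bid_less[of x y] bid_le[of y x] by force

lemma isCont_bid_inv:
  assumes "0 < x" "x < 1" shows "isCont bid_inv (bid x)"
proof -
  have "continuous_on (bid ` {0..1}) bid_inv"
    using bid_cont by (rule continuous_on_inv) (auto simp: bid_inv_bid)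
  then have "continuous_on {0..bid 1} bid_inv" by (simp add: bid_image)
  then show ?thesis
    using bid_less[of 0 x] bid_less[of x 1] assms bid_0
    by (intro continuous_on_interior) auto
qed

lemma integrable_weight_tail: "integrable unif01 (\<lambda>\<theta>. indicator {x<..} \<theta> * weighted_deriv \<theta>)"
proof (rule integrable_unif01_bounded[where K = "real (N - 1)"])
  have "{x<..} \<inter> {0..1} \<in> sets unif01" by (intro sets_unif01_subset) auto
  then have "(indicator ({x<..} \<inter> {0..1}) :: real \<Rightarrow> real) \<in> borel_measurable unif01"
    by (rule borel_measurable_indicator)
  also have "?this \<longleftrightarrow> (indicator {x<..} :: real \<Rightarrow> real) \<in> borel_measurable unif01"
    by (rule measurable_cong) (auto simp: indicator_def)
  finally show "(\<lambda>\<theta>. indicator {x<..} \<theta> * weighted_deriv \<theta>) \<in> borel_measurable unif01"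
    using weighted_deriv_measurable by (rule borel_measurable_times)
  show "\<bar>indicator {x<..} s * weighted_deriv s\<bar> \<le> real (N - 1)" if "s \<in> {0..1}" for s
    using abs_weighted_deriv_le[OF that] by (auto split: split_indicator)
qed

lemma weight_tail_diff:
  assumes "0 \<le> a" "a \<le> b" "b \<le> 1"
  shows "weight_tail a - weight_tail b = (LBINT s=a..b. weight s * bid_deriv s)"
    and "set_integrable lborel {a<..<b} (\<lambda>s. weight s * bid_deriv s)"
proof -
  \<comment> \<open>The interval open at \<open>a\<close> avoids the type 0, where
    \<open>weight\<close> is 0 by the convention for division and the product with
    \<open>bid_deriv\<close> is not \<open>weighted_deriv\<close>.\<close>
  have *: "indicator {0..1} s * (indicator {a<..} s * weighted_deriv s - indicator {b<..} s * weighted_deriv s)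
      = indicator {a<..b} s * (weight s * bid_deriv s)" for s
    using assms weighted_deriv_eq[of s] by (auto split: split_indicator)
  have "weight_tail a - weight_tail b = (\<integral>s. indicator {a<..} s * weighted_deriv s - indicator {b<..} s * weighted_deriv s \<partial>unif01)"
    unfolding weight_tail_def using integrable_weight_tail by (intro Bochner_Integration.integral_diff[symmetric])
  also have "\<dots> = (LBINT s:{a<..b}. weight s * bid_deriv s)"
    unfolding integral_unif01 * set_lebesgue_integral_def by simp
  finally show "weight_tail a - weight_tail b = (LBINT s=a..b. weight s * bid_deriv s)"
    using assms by (simp add: interval_integral_Ioc)
  have "integrable unif01 (\<lambda>s. indicator {a<..} s * weighted_deriv s - indicator {b<..} s * weighted_deriv s)"
    by (intro Bochner_Integration.integrable_diff integrable_weight_tail)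
  then have "set_integrable lborel {a<..b} (\<lambda>s. weight s * bid_deriv s)"
    by (simp add: integrable_restrict_space set_integrable_def *)
  then show "set_integrable lborel {a<..<b} (\<lambda>s. weight s * bid_deriv s)"
    by (rule set_integrable_subset) auto
qed

text \<open>Continuity and two-sided derivatives are available only for interior types, so the
  substitution rule for nonnegative integrands is used, with \<open>A\<close> and \<open>B\<close>
  supplying the limits at the endpoints. That rule also yields integrability of the possibly
  unbounded left integrand.\<close>

lemma weight_substitution:
  assumes ab: "0 \<le> a" "a < b" "b \<le> 1"
  shows "set_integrable lborel {bid a<..<bid b} (\<lambda>\<mu>. weight (bid_inv \<mu>))"
    and "(LBINT \<mu>=bid a..bid b. weight (bid_inv \<mu>)) = weight_tail a - weight_tail b"
proof -
  have lim: "(bid \<longlongrightarrow> bid x) (at x within {0..1})" if "x \<in> {0..1}" for x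
    using bid_cont that by (auto simp: continuous_on_def)
  have A: "((ereal \<circ> bid \<circ> real_of_ereal) \<longlongrightarrow> ereal (bid a)) (at_right (ereal a))"
  proof -
    have "(bid \<longlongrightarrow> bid a) (at a within {a..1})"
      using ab by (intro tendsto_within_subset[OF lim]) auto
    then show ?thesis using ab by (simp add: ereal_tendsto_simps at_within_Icc_at_right)
  qed
  have B: "((ereal \<circ> bid \<circ> real_of_ereal) \<longlongrightarrow> ereal (bid b)) (at_left (ereal b))"
  proof -
    have "(bid \<longlongrightarrow> bid b) (at b within {0..b})"
      using ab by (intro tendsto_within_subset[OF lim]) auto
    then show ?thesis using ab by (simp add: ereal_tendsto_simps at_within_Icc_at_left)
  qed
  have cont: "isCont (\<lambda>\<mu>. weight (bid_inv \<mu>)) (bid x)" if "a < x" "x < b" for x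
    using isCont_o2[OF isCont_bid_inv[of x], of weight] isCont_weight[of x] that ab
    by (simp add: bid_inv_bid)
  have eq: "weight (bid_inv (bid x)) * bid_deriv x = weight x * bid_deriv x" if "x \<in> {a<..<b}" for x
    using that ab by (simp add: bid_inv_bid)
  have int: "set_integrable lborel (einterval a b) (\<lambda>x. weight (bid_inv (bid x)) * bid_deriv x)"
  proof -
    have "set_integrable lborel {a<..<b} (\<lambda>x. weight (bid_inv (bid x)) * bid_deriv x)
        \<longleftrightarrow> set_integrable lborel {a<..<b} (\<lambda>s. weight s * bid_deriv s)"
      by (intro set_integrable_cong refl eq)
    then show ?thesis using weight_tail_diff(2)[of a b] ab by simp
  qed
  note subst = interval_integral_substitution_nonneg[where a = "ereal a" and b = "ereal b"
      and f = "\<lambda>\<mu>. weight (bid_inv \<mu>)" and g = bid and g' = bid_deriv, OF _ _ _ _ _ _ A B int]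
  have prems: "ereal a < ereal b"
    "\<And>x. ereal a < ereal x \<Longrightarrow> ereal x < ereal b \<Longrightarrow> DERIV bid x :> bid_deriv x"
    "\<And>x. ereal a < ereal x \<Longrightarrow> ereal x < ereal b \<Longrightarrow> isCont (\<lambda>\<mu>. weight (bid_inv \<mu>)) (bid x)"
    "\<And>x. ereal a < ereal x \<Longrightarrow> ereal x < ereal b \<Longrightarrow> isCont bid_deriv x"
    "\<And>x. ereal a < ereal x \<Longrightarrow> ereal x < ereal b \<Longrightarrow> 0 \<le> weight (bid_inv (bid x))"
    "\<And>x. ereal a \<le> ereal x \<Longrightarrow> ereal x \<le> ereal b \<Longrightarrow> 0 \<le> bid_deriv x"
    using ab cont
    by (auto intro!: bid_has_deriv isCont_bid_deriv bid_deriv_nonneg weight_nonneg simp: bid_inv_bid)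
  show "set_integrable lborel {bid a<..<bid b} (\<lambda>\<mu>. weight (bid_inv \<mu>))"
    using subst(1)[OF prems] by simp
  have "(LBINT \<mu>=bid a..bid b. weight (bid_inv \<mu>))
      = (LBINT x=a..b. weight (bid_inv (bid x)) * bid_deriv x)"
    by (rule subst(2)[OF prems])
  also have "\<dots> = (LBINT x=a..b. weight x * bid_deriv x)"
    using ab by (intro interval_integral_cong) (auto simp: eq)
  also have "\<dots> = weight_tail a - weight_tail b"
    using weight_tail_diff(1)[of a b] ab by simp
  finally show "(LBINT \<mu>=bid a..bid b. weight (bid_inv \<mu>)) = weight_tail a - weight_tail b" .
qed

lemma weight_integral:
  assumes "x \<in> {0..1}" "y \<in> {0..1}"
  shows "(LBINT \<mu>=bid x..bid y. weight (bid_inv \<mu>)) = weight_tail x - weight_tail y"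
proof (cases x y rule: linorder_cases)
  case greater
  then show ?thesis
    using weight_substitution(2)[of y x] assms
    by (subst interval_integral_endpoints_reverse) simp
qed (use weight_substitution(2)[of x y] assms in auto)

text \<open>In bid coordinates the difference is an integral of a decreasing function, bounded below
  by its value at the upper end times the length.\<close>

lemma weight_tail_diff_ge:
  assumes "0 \<le> a" "a < b" "b \<le> 1"
  shows "weight b * (bid b - bid a) \<le> weight_tail a - weight_tail b"
proof -
  have less: "bid a < bid b" using assms by (rule bid_less)
  have "weight b * (bid b - bid a) = (LBINT \<mu>:{bid a<..<bid b}. weight b)"
    using less by (simp add: set_lebesgue_integral_def)
  also have "\<dots> \<le> (LBINT \<mu>:{bid a<..<bid b}. weight (bid_inv \<mu>))"
  proof (rule set_integral_mono)
    fix \<mu> assume \<mu>: "\<mu> \<in> {bid a<..<bid b}"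
    then have m: "\<mu> \<in> {0..bid 1}"
      using bid_nonneg[of a] bid_le[of b 1] assms by auto
    define s where "s = bid_inv \<mu>"
    have s: "s \<in> {0..1}" "bid s = \<mu>" using bid_inv_mem[OF m] bid_bid_inv[OF m] by (auto simp: s_def)
    then have "a < s" "s < b" using \<mu> bid_less_iff[of a s] bid_less_iff[of s b] assms by auto
    then show "weight b \<le> weight (bid_inv \<mu>)"
      using weight_less[of s b] assms by (simp add: s_def)
  qed (use weight_substitution(1)[OF assms] set_integrable_const_Ioo in auto)
  also have "\<dots> = weight_tail a - weight_tail b"
    using weight_substitution(2)[OF assms] less by (simp add: interval_integral_Ioo)
  finally show ?thesis .
qed

text \<open>The bound by the value at the lower end requires \<open>0 < a\<close>, because
  \<open>weight 0\<close> has the default value 0 and is not an upper bound.\<close>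

lemma weight_tail_diff_le:
  assumes "0 < a" "a < b" "b \<le> 1"
  shows "weight_tail a - weight_tail b \<le> weight a * (bid b - bid a)"
proof -
  have ab: "0 \<le> a" using assms by simp
  have less: "bid a < bid b" using ab assms(2,3) by (rule bid_less)
  have "weight_tail a - weight_tail b = (LBINT \<mu>:{bid a<..<bid b}. weight (bid_inv \<mu>))"
    using weight_substitution(2)[OF ab assms(2,3)] less by (simp add: interval_integral_Ioo)
  also have "\<dots> \<le> (LBINT \<mu>:{bid a<..<bid b}. weight a)"
  proof (rule set_integral_mono)
    fix \<mu> assume \<mu>: "\<mu> \<in> {bid a<..<bid b}"
    then have m: "\<mu> \<in> {0..bid 1}"
      using bid_nonneg[of a] bid_le[of b 1] assms by auto
    define s where "s = bid_inv \<mu>"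
    have s: "s \<in> {0..1}" "bid s = \<mu>" using bid_inv_mem[OF m] bid_bid_inv[OF m] by (auto simp: s_def)
    then have "a < s" "s < b" using \<mu> bid_less_iff[of a s] bid_less_iff[of s b] assms by auto
    then show "weight (bid_inv \<mu>) \<le> weight a"
      using weight_less[of a s] assms by (simp add: s_def)
  qed (use weight_substitution(1)[OF ab assms(2,3)] set_integrable_const_Ioo in auto)
  also have "\<dots> = weight a * (bid b - bid a)"
    using less by (simp add: set_lebesgue_integral_def)
  finally show ?thesis .
qed

text \<open>Splitting at the midpoint gains strictness: on the lower half the weight is already at
  least \<open>weight m\<close>, which exceeds \<open>weight b\<close>.\<close>

lemma weight_tail_diff_greater:
  assumes "0 \<le> a" "a < b" "b \<le> 1"
  shows "weight b * (bid b - bid a) < weight_tail a - weight_tail b"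
proof -
  define m where "m = (a + b) / 2"
  have m: "a < m" "m < b" using assms by (auto simp: m_def)
  have "weight b * (bid m - bid a) < weight m * (bid m - bid a)"
    using weight_less[of m b] bid_less[of a m] m assms by (intro mult_strict_right_mono) auto
  then show ?thesis
    using weight_tail_diff_ge[of a m] weight_tail_diff_ge[of m b] m assms by (simp add: algebra_simps)
qed

lemma weight_tail_diff_less:
  assumes "0 < a" "a < b" "b \<le> 1"
  shows "weight_tail a - weight_tail b < weight a * (bid b - bid a)"
proof -
  define m where "m = (a + b) / 2"
  have m: "a < m" "m < b" using assms by (auto simp: m_def)
  have "weight m * (bid b - bid m) < weight a * (bid b - bid m)"
    using weight_less[of a m] bid_less[of m b] m assms by (intro mult_strict_right_mono) auto
  then show ?thesis
    using weight_tail_diff_le[of a m] weight_tail_diff_le[of m b] m assms by (simp add: algebra_simps)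
qed

lemma weight_tail_antimono: "a \<in> {0..1} \<Longrightarrow> b \<in> {0..1} \<Longrightarrow> a \<le> b \<Longrightarrow> weight_tail b \<le> weight_tail a"
  using weight_tail_diff_ge[of a b] mult_nonneg_nonneg[OF weight_nonneg[of b], of "bid b - bid a"] bid_le[of a b]
  by (cases "a = b") (auto simp del: mult_nonneg_nonneg)

lemma weight_tail_nonneg: "0 \<le> weight_tail x"
  unfolding weight_tail_def using weighted_deriv_nonneg by (intro integral_nonneg_AE AE_I2) (auto split: split_indicator)

lemma weight_tail_le: "weight_tail x \<le> real (N - 1)"
proof -
  interpret prob_space unif01 by (rule prob_space_unif01)
  show ?thesis
    unfolding weight_tail_def
  proof (rule integral_le_const[OF integrable_weight_tail AE_I2])
    show "indicator {x<..} s * weighted_deriv s \<le> real (N - 1)" if "s \<in> space unif01" for s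
      using weighted_deriv_le[of s] that by (auto split: split_indicator)
  qed
qed

text \<open>The type whose canonical bid is \<open>y\<close>. Truncating at \<open>bid 1\<close>
  preserves every comparison with a canonical bid, since no type bids more than
  \<open>bid 1\<close>; see \<open>bid_type_less_iff\<close>.\<close>

definition bid_type :: "real \<Rightarrow> real" where
  "bid_type y = bid_inv (min y (bid 1))"

lemma bid_1_pos: "0 < bid 1"
  using bid_less[of 0 1] bid_0 by simp

lemma bid_type_mem: "0 \<le> y \<Longrightarrow> bid_type y \<in> {0..1}"
  unfolding bid_type_def using bid_1_pos by (intro bid_inv_mem) auto

lemma bid_bid_type: "0 \<le> y \<Longrightarrow> bid (bid_type y) = min y (bid 1)"
  unfolding bid_type_def using bid_1_pos by (intro bid_bid_inv) auto

lemma bid_type_less_iff: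
  assumes "0 \<le> y" "x \<in> {0..1}" shows "bid_type y < x \<longleftrightarrow> y < bid x"
  using bid_less_iff[OF bid_type_mem[OF assms(1)] assms(2)] bid_bid_type[OF assms(1)]
    bid_le[of x 1] assms(2) by auto

lemma bid_type_mono:
  assumes "0 \<le> y" "y \<le> z" shows "bid_type y \<le> bid_type z"
  using bid_less_iff[OF bid_type_mem[of z] bid_type_mem[of y]] assms by (auto simp: bid_bid_type)

lemma power_weight: "x \<in> {0..1} \<Longrightarrow>
    x ^ (N - 2) * weight x = (case fmt of First_Price \<Rightarrow> x ^ (N - 1) / v x | All_Pay \<Rightarrow> 1 / v x)"
proof -
  obtain n where n: "N = Suc (Suc n)" using N by (metis add_2_eq_Suc le_Suc_ex)
  show ?thesis unfolding weight_def by (cases fmt) (auto simp: n)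
qed

lemma alpha_eq:
  assumes \<theta>: "\<theta> \<in> {0..1}" and y: "0 \<le> l i \<theta>" and zero: "\<theta> = 0 \<Longrightarrow> l i \<theta> = 0"
  shows "alpha fmt N v l i \<theta> = \<theta> ^ (N - 2) *
    (weight \<theta> * (l i \<theta> - bid \<theta>) - (weight_tail \<theta> - weight_tail (bid_type (l i \<theta>))))"
proof -
  have int: "(LBINT \<mu>=bid \<theta>..min (l i \<theta>) (bid 1). weight (bid_inv \<mu>))
      = weight_tail \<theta> - weight_tail (bid_type (l i \<theta>))"
    using weight_integral[OF \<theta> bid_type_mem[OF y]] by (simp add: bid_bid_type[OF y])
  show ?thesis
  proof (cases fmt)
    case First_Price
    have b: "canonical_bid First_Price N v = bid" unfolding bid_def by (simp only: First_Price)
    have w: "weight = (\<lambda>x. x / v x)" unfolding weight_def[abs_def] by (simp add: First_Price)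
    have "alpha fmt N v l i \<theta> = alpha First_Price N v l i \<theta>" by (simp only: First_Price)
    also have "\<dots> = \<theta> ^ (N - 2) * (weight \<theta> * (l i \<theta> - bid \<theta>) - (weight_tail \<theta> - weight_tail (bid_type (l i \<theta>))))"
      unfolding alpha.simps Let_def b bid_inv_def[symmetric] int[symmetric] w ..
    finally show ?thesis .
  next
    case All_Pay
    have b: "canonical_bid All_Pay N v = bid" unfolding bid_def by (simp only: All_Pay)
    have w: "weight = (\<lambda>x. 1 / (x ^ (N - 2) * v x))" unfolding weight_def[abs_def] by (simp add: All_Pay)
    have "(LBINT \<mu>=bid \<theta>..min (l i \<theta>) (bid 1). \<theta> ^ (N - 2) / (bid_inv \<mu> ^ (N - 2) * v (bid_inv \<mu>)))
        = (LBINT \<mu>=bid \<theta>..min (l i \<theta>) (bid 1). \<theta> ^ (N - 2) * weight (bid_inv \<mu>))"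
      by (simp add: w)
    also have "\<dots> = \<theta> ^ (N - 2) * (LBINT \<mu>=bid \<theta>..min (l i \<theta>) (bid 1). weight (bid_inv \<mu>))"
      by (simp add: interval_lebesgue_integral_def)
    finally have "alpha All_Pay N v l i \<theta> = (l i \<theta> - bid \<theta>) / v \<theta>
        - \<theta> ^ (N - 2) * (weight_tail \<theta> - weight_tail (bid_type (l i \<theta>)))"
      unfolding alpha.simps Let_def b bid_inv_def[symmetric] int[symmetric] by simp
    moreover have "(l i \<theta> - bid \<theta>) / v \<theta> = \<theta> ^ (N - 2) * weight \<theta> * (l i \<theta> - bid \<theta>)"
      using power_weight[OF \<theta>] All_Pay by simp
    ultimately show ?thesis using All_Pay by (simp add: algebra_simps)
  qed
qed

text \<open>The rectangle of height \<open>weight \<theta>\<close> between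
  \<open>bid \<theta>\<close> and \<open>y\<close> is compared with the oriented integral of a
  decreasing function. Above \<open>bid \<theta>\<close> the integrand is smaller than the height;
  below it is larger, but the orientation is reversed.\<close>

lemma alpha_kernel_pos:
  assumes "0 < \<theta>" "\<theta> \<le> 1" "0 \<le> y" "y \<noteq> bid \<theta>"
  shows "0 < weight \<theta> * (y - bid \<theta>) - (weight_tail \<theta> - weight_tail (bid_type y))"
proof -
  let ?p = "bid_type y"
  have p: "?p \<in> {0..1}" "bid ?p = min y (bid 1)"
    using assms bid_type_mem bid_bid_type by auto
  have w: "0 < weight \<theta>" using assms weight_pos by auto
  show ?thesis
  proof (cases ?p \<theta> rule: linorder_cases)
    case less
    then have "y < bid \<theta>" using bid_type_less_iff[of y \<theta>] assms by auto
    then have "bid ?p = y" using p(2) bid_le[of \<theta> 1] assms by auto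
    then show ?thesis using weight_tail_diff_greater[of ?p \<theta>] less p assms by (simp add: algebra_simps)
  next
    case equal
    \<comment> \<open>Here \<open>y\<close> differs from \<open>bid \<theta>\<close> but has the
      same truncation, so \<theta> = 1 and \<open>y\<close> overbids every type: the integral
      vanishes and the linear term is positive.\<close>
    then have "bid \<theta> < y" using p(2) assms(4) by auto
    then show ?thesis using w equal by simp
  next
    case greater
    have "weight \<theta> * (bid ?p - bid \<theta>) \<le> weight \<theta> * (y - bid \<theta>)"
      using w p(2) by (intro mult_left_mono) auto
    then show ?thesis using weight_tail_diff_less[of \<theta> ?p] greater p assms by simp
  qed
qed

end

section \<open>The constraint of the linear program\<close>

text \<open>The bound \<open>M * v x\<close> forces \<open>f 0 = 0\<close> and keeps f / v bounded
  near the type 0. Integrability of the payment terms rests on it.\<close>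

locale symmetric_profile = quantile_auction_format +
  fixes l :: profile and f :: "real \<Rightarrow> real" and M :: real
  assumes l_eq: "j < N \<Longrightarrow> l j = f" and f_mono: "mono_on {0..1} f"
    and f_nonneg: "x \<in> {0..1} \<Longrightarrow> 0 \<le> f x" and f_le: "x \<in> {0..1} \<Longrightarrow> f x \<le> M * v x"
    and M: "1 \<le> M"
begin

lemma f_0: "f 0 = 0"
  using f_nonneg[of 0] f_le[of 0] by simp

lemma f_ratio: assumes "x \<in> {0..1}" shows "0 \<le> f x / v x" "f x / v x \<le> M"
proof -
  show "0 \<le> f x / v x" using f_nonneg[OF assms] v_nonneg[of x] assms by simp
  show "f x / v x \<le> M"
    using f_le[OF assms] v_pos[of x] M assms by (cases "x = 0") (auto simp: divide_le_eq)
qed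

lemma bid_ratio: assumes "x \<in> {0..1}" shows "0 \<le> bid x / v x" "bid x / v x \<le> 1"
  using bid_nonneg[of x] v_nonneg[of x] bid_le_v[of x] assms by (auto simp: divide_le_eq_1)

lemma f_measurable: "f \<in> borel_measurable unif01"
  using f_mono by (rule mono_on_measurable_unif01)

lemma win_prob_f_measurable:
  "i < N \<Longrightarrow> (\<lambda>\<theta>. win_prob N f i (f \<theta>)) \<in> borel_measurable unif01"
  "i < N \<Longrightarrow> (\<lambda>\<theta>. win_prob N f i (bid \<theta>)) \<in> borel_measurable unif01"
  by (rule measurable_compose[OF _ measurable_win_prob], rule f_measurable bid_measurable,
      assumption, rule f_measurable)+

text \<open>Payments saved by deviating, relative to \<open>v\<close>. An all-pay deviator pays
  \<open>bid \<theta>\<close> in any case, so it is subtracted here; a first-price deviator pays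
  only on winning, which \<open>win_gain\<close> accounts for.\<close>

definition surplus :: "nat \<Rightarrow> real \<Rightarrow> real" where
  "surplus i \<theta> = (case fmt of First_Price \<Rightarrow> win_prob N f i (f \<theta>) * (f \<theta> / v \<theta>)
      | All_Pay \<Rightarrow> f \<theta> / v \<theta> - bid \<theta> / v \<theta>)"

definition win_gain :: "nat \<Rightarrow> real \<Rightarrow> real" where
  "win_gain i \<theta> = win_prob N f i (bid \<theta>) * (weighted_deriv \<theta> / real (N - 1))"

lemma canonical_gain_cases:
  assumes "i < N"
  shows "canonical_gain fmt N v l i \<theta> = (case fmt of
      First_Price \<Rightarrow> win_prob N f i (bid \<theta>) * (v \<theta> - bid \<theta>) - win_prob N f i (f \<theta>) * (v \<theta> - f \<theta>)
    | All_Pay \<Rightarrow> (win_prob N f i (bid \<theta>) - win_prob N f i (f \<theta>)) * v \<theta> + (f \<theta> - bid \<theta>))"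
  unfolding bid_def using canonical_gain_eq[OF assms l_eq f_measurable, where v = v and \<theta> = \<theta>]
  by (cases fmt) (auto simp: Let_def simp del: canonical_bid.simps)

text \<open>The three terms are treated separately: the first is bounded below through Fubini, the
  second has total mass 1 over the buyers, and the third is bounded below by comparing
  allocations.\<close>

lemma gain_ratio_eq:
  assumes "i < N" "0 < \<theta>" "\<theta> \<le> 1"
  shows "1 / v \<theta> * canonical_gain fmt N v l i \<theta>
    = win_gain i \<theta> - win_prob N f i (f \<theta>) + surplus i \<theta>"
  unfolding canonical_gain_cases[OF assms(1)] win_gain_def surplus_def weighted_deriv_def
  using v_pos[OF assms(2,3)] N by (cases fmt) (auto simp: field_simps)

lemma gain_ratio_measurable:
  assumes "i < N" shows "(\<lambda>\<theta>. 1 / v \<theta> * canonical_gain fmt N v l i \<theta>) \<in> borel_measurable unif01"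
  unfolding canonical_gain_cases[OF assms]
  using win_prob_f_measurable[OF assms] v_measurable bid_measurable f_measurable
  by (cases fmt) auto

lemma win_gain_bounds:
  assumes "i < N" "\<theta> \<in> {0..1}" shows "0 \<le> win_gain i \<theta>" "win_gain i \<theta> \<le> 1"
proof -
  have d: "0 \<le> weighted_deriv \<theta> / real (N - 1)" "weighted_deriv \<theta> / real (N - 1) \<le> 1"
    using weighted_deriv_nonneg[of \<theta>] weighted_deriv_le[of \<theta>] assms N by (auto simp: divide_le_eq_1)
  show "0 \<le> win_gain i \<theta>"
    unfolding win_gain_def using d(1) by (intro mult_nonneg_nonneg win_prob_nonneg)
  show "win_gain i \<theta> \<le> 1"
    unfolding win_gain_def using d win_prob_le_1[OF assms(1) f_measurable]
    by (intro mult_le_one)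
qed

lemma surplus_bounds:
  assumes "i < N" "\<theta> \<in> {0..1}" shows "- 1 \<le> surplus i \<theta>" "surplus i \<theta> \<le> M"
proof -
  have "win_prob N f i (f \<theta>) * (f \<theta> / v \<theta>) \<le> 1 * M"
    using win_prob_le_1[OF assms(1) f_measurable] f_ratio[OF assms(2)] by (intro mult_mono) auto
  moreover have "0 \<le> win_prob N f i (f \<theta>) * (f \<theta> / v \<theta>)"
    using f_ratio[OF assms(2)] by (intro mult_nonneg_nonneg win_prob_nonneg)
  ultimately show "- 1 \<le> surplus i \<theta>" "surplus i \<theta> \<le> M"
    unfolding surplus_def using f_ratio[OF assms(2)] bid_ratio[OF assms(2)] by (cases fmt; simp)+
qed

lemma gain_ratio_bound:
  assumes "i < N" "\<theta> \<in> {0..1}"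
  shows "\<bar>1 / v \<theta> * canonical_gain fmt N v l i \<theta>\<bar> \<le> 2 + M"
proof (cases "\<theta> = 0")
  case False
  then show ?thesis
    using gain_ratio_eq[of i \<theta>] win_gain_bounds[OF assms] surplus_bounds[OF assms]
      win_prob_nonneg[of N f i "f \<theta>"] win_prob_le_1[OF assms(1) f_measurable, of "f \<theta>"] assms M
    by auto
qed (use M in simp)

lemma integrable_gain_ratio:
  "i < N \<Longrightarrow> integrable unif01 (\<lambda>\<theta>. 1 / v \<theta> * canonical_gain fmt N v l i \<theta>)"
  using gain_ratio_measurable gain_ratio_bound by (rule integrable_unif01_bounded)

lemma integrable_win_gain: assumes "i < N" shows "integrable unif01 (win_gain i)"
proof (rule integrable_unif01_bounded[where K = 1])
  show "win_gain i \<in> borel_measurable unif01"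
    unfolding win_gain_def[abs_def] using win_prob_f_measurable[OF assms] weighted_deriv_measurable by auto
qed (use win_gain_bounds[OF assms] in force)

lemma integrable_surplus: assumes "i < N" shows "integrable unif01 (surplus i)"
proof (rule integrable_unif01_bounded[where K = M])
  show "surplus i \<in> borel_measurable unif01"
    unfolding surplus_def[abs_def]
    using win_prob_f_measurable[OF assms] v_measurable bid_measurable f_measurable by (cases fmt) auto
qed (use surplus_bounds[OF assms] M in force)

lemma integrable_win_prob_f:
  assumes "i < N" shows "integrable unif01 (\<lambda>\<theta>. win_prob N f i (f \<theta>))"
  using win_prob_f_measurable(1)[OF assms] win_prob_le_1[OF assms f_measurable]
  by (intro integrable_unif01_bounded[where K = 1]) (auto simp: win_prob_nonneg)

section \<open>Decomposition of \<alpha> and its integral\<close>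

definition kernel :: "(real \<Rightarrow> real) \<Rightarrow> real \<Rightarrow> real" where
  "kernel g \<theta> = \<theta> ^ (N - 2) * weight \<theta> * g \<theta>"

definition tail_kernel :: "(real \<Rightarrow> real) \<Rightarrow> real \<Rightarrow> real" where
  "tail_kernel \<phi> \<theta> = \<theta> ^ (N - 2) * weight_tail (\<phi> \<theta>)"

definition sunk :: "real \<Rightarrow> real" where
  "sunk \<theta> = (case fmt of First_Price \<Rightarrow> 0 | All_Pay \<Rightarrow> bid \<theta> / v \<theta>)"

definition profile_type :: "real \<Rightarrow> real" where
  "profile_type \<theta> = bid_type (f \<theta>)"

lemma kernel_eq: "\<theta> \<in> {0..1} \<Longrightarrow> kernel g \<theta> =
    (case fmt of First_Price \<Rightarrow> \<theta> ^ (N - 1) * (g \<theta> / v \<theta>) | All_Pay \<Rightarrow> g \<theta> / v \<theta>)"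
  unfolding kernel_def by (subst power_weight) (auto split: auction_format.split)

lemma integrable_kernel:
  assumes "g \<in> borel_measurable unif01" "\<And>\<theta>. \<theta> \<in> {0..1} \<Longrightarrow> 0 \<le> g \<theta> / v \<theta> \<and> g \<theta> / v \<theta> \<le> K"
  shows "integrable unif01 (kernel g)"
proof (rule integrable_unif01_bounded[where K = K])
  have "(\<lambda>\<theta>. case fmt of First_Price \<Rightarrow> \<theta> ^ (N - 1) * (g \<theta> / v \<theta>) | All_Pay \<Rightarrow> g \<theta> / v \<theta>)
      \<in> borel_measurable unif01"
    using assms(1) v_measurable ident_measurable_unif01 by (cases fmt) auto
  then show "kernel g \<in> borel_measurable unif01"
    by (subst measurable_cong[OF kernel_eq]) auto
  show "\<bar>kernel g \<theta>\<bar> \<le> K" if "\<theta> \<in> {0..1}" for \<theta>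
  proof -
    have "\<theta> ^ (N - 1) * (g \<theta> / v \<theta>) \<le> 1 * K"
      using assms(2)[OF that] that by (intro mult_mono power_le_one) auto
    moreover have "0 \<le> \<theta> ^ (N - 1) * (g \<theta> / v \<theta>)"
      using assms(2)[OF that] that by (intro mult_nonneg_nonneg) auto
    ultimately show ?thesis
      using assms(2)[OF that] unfolding kernel_eq[OF that]
      by (cases fmt) (auto simp del: times_divide_eq_right)
  qed
qed

lemma integrable_tail_kernel:
  assumes "mono_on {0..1} \<phi>" "\<And>\<theta>. \<theta> \<in> {0..1} \<Longrightarrow> \<phi> \<theta> \<in> {0..1}"
  shows "integrable unif01 (tail_kernel \<phi>)"
proof (rule integrable_unif01_bounded[where K = "real (N - 1)"])
  have "mono_on {0..1} (\<lambda>\<theta>. - weight_tail (\<phi> \<theta>))"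
    using assms by (intro mono_onI) (simp add: weight_tail_antimono mono_onD)
  then have "(\<lambda>\<theta>. - (- weight_tail (\<phi> \<theta>))) \<in> borel_measurable unif01"
    by (intro borel_measurable_uminus mono_on_measurable_unif01)
  then show "tail_kernel \<phi> \<in> borel_measurable unif01"
    unfolding tail_kernel_def[abs_def] using ident_measurable_unif01 by auto
  show "\<bar>tail_kernel \<phi> \<theta>\<bar> \<le> real (N - 1)" if "\<theta> \<in> {0..1}" for \<theta>
    using that mult_mono[of "\<theta> ^ (N - 2)" 1 "weight_tail (\<phi> \<theta>)" "real (N - 1)"] weight_tail_nonneg[of "\<phi> \<theta>"] weight_tail_le
    by (auto simp: tail_kernel_def abs_mult power_le_one)
qed

lemma profile_type_mem: "\<theta> \<in> {0..1} \<Longrightarrow> profile_type \<theta> \<in> {0..1}"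
  unfolding profile_type_def by (intro bid_type_mem f_nonneg)

lemma profile_type_mono: "mono_on {0..1} profile_type"
  unfolding profile_type_def using f_mono f_nonneg
  by (intro mono_onI bid_type_mono) (auto simp: mono_on_def)

text \<open>The density of the highest rival type contributes the factor \<open>Suc (N - 2)\<close>,
  which the normalisation of \<open>weighted_deriv\<close> removes.\<close>

lemma integral_tail_kernel:
  assumes "mono_on {0..1} \<phi>"
  shows "(\<integral>\<theta>. measure unif01 {s \<in> {0..1}. \<phi> s < \<theta>} ^ (N - 1) * (weighted_deriv \<theta> / real (N - 1)) \<partial>unif01)
    = (\<integral>\<theta>. tail_kernel \<phi> \<theta> \<partial>unif01)"
proof -
  have n: "N - 1 = Suc (N - 2)" using N by simp
  have "(\<integral>\<theta>. measure unif01 {s \<in> {0..1}. \<phi> s < \<theta>} ^ (N - 1) * weighted_deriv \<theta> \<partial>unif01)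
      = real (N - 1) * (\<integral>\<theta>. tail_kernel \<phi> \<theta> \<partial>unif01)"
    using integral_measure_power_weighted[OF assms weighted_deriv_measurable abs_weighted_deriv_le, of "N - 2"]
    unfolding n weight_tail_def[symmetric] tail_kernel_def mult.assoc by simp
  then show ?thesis using N by (simp add: field_simps)
qed

lemma integral_power_unif01: "(\<integral>\<theta>. \<theta> ^ (N - 1) \<partial>unif01) = 1 / real N"
proof -
  have "(\<integral>\<theta>. \<theta> ^ (N - 1) \<partial>unif01) = (\<integral>\<theta>. \<theta> ^ (N - 1) * indicator {0..1} \<theta> \<partial>lborel)"
    by (simp add: integral_unif01 mult.commute)
  also have "\<dots> = 1 / real N"
    using integral_power[of 0 1 "N - 1"] N by simp
  finally show ?thesis .
qed

lemma integrable_sunk: "integrable unif01 sunk"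
proof (rule integrable_unif01_bounded[where K = 1])
  show "sunk \<in> borel_measurable unif01"
    unfolding sunk_def[abs_def] using v_measurable bid_measurable by (cases fmt) auto
  show "\<bar>sunk \<theta>\<bar> \<le> 1" if "\<theta> \<in> {0..1}" for \<theta>
    unfolding sunk_def using bid_ratio[OF that] by (cases fmt) auto
qed

lemma integrable_pieces:
  "integrable unif01 (kernel f)" "integrable unif01 (kernel bid)"
  "integrable unif01 (tail_kernel profile_type)" "integrable unif01 (tail_kernel (\<lambda>\<theta>. \<theta>))"
  using integrable_kernel[OF f_measurable, of M] integrable_kernel[OF bid_measurable, of 1]
    f_ratio bid_ratio integrable_tail_kernel[OF profile_type_mono profile_type_mem]
    integrable_tail_kernel[of "\<lambda>\<theta>. \<theta>"]
  by (auto simp: mono_on_def)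

text \<open>This says that the constraint of the linear program holds with equality at \<open>\<lambda> = \<beta>\<close>.\<close>

lemma integral_equilibrium:
  "(\<integral>\<theta>. kernel bid \<theta> \<partial>unif01) + (\<integral>\<theta>. tail_kernel (\<lambda>\<theta>. \<theta>) \<theta> \<partial>unif01)
    - (\<integral>\<theta>. sunk \<theta> \<partial>unif01) = 1 / real N"
proof -
  let ?p = "\<lambda>\<theta>. \<theta> ^ (N - 1) * (weighted_deriv \<theta> / real (N - 1))"
  have int_p: "integrable unif01 ?p"
  proof (rule integrable_unif01_bounded[where K = 1])
    show "?p \<in> borel_measurable unif01" using weighted_deriv_measurable ident_measurable_unif01 by auto
    show "\<bar>?p \<theta>\<bar> \<le> 1" if "\<theta> \<in> {0..1}" for \<theta>
      unfolding abs_mult using weighted_deriv_nonneg[of \<theta>] weighted_deriv_le[of \<theta>] that N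
      by (intro mult_le_one) (auto simp: power_le_one divide_le_eq_1)
  qed
  have "(\<integral>\<theta>. tail_kernel (\<lambda>\<theta>. \<theta>) \<theta> \<partial>unif01) = (\<integral>\<theta>. ?p \<theta> \<partial>unif01)"
  proof -
    have "mono_on {0..1} (\<lambda>\<theta>::real. \<theta>)" by (simp add: mono_on_def)
    from integral_tail_kernel[OF this, symmetric] show ?thesis
      by (rule trans) (intro Bochner_Integration.integral_cong refl, subst measure_unif01_less, auto)
  qed
  then have "(\<integral>\<theta>. kernel bid \<theta> \<partial>unif01) + (\<integral>\<theta>. tail_kernel (\<lambda>\<theta>. \<theta>) \<theta> \<partial>unif01)
      - (\<integral>\<theta>. sunk \<theta> \<partial>unif01) = (\<integral>\<theta>. kernel bid \<theta> + ?p \<theta> - sunk \<theta> \<partial>unif01)"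
    using integrable_pieces(2) int_p integrable_sunk by simp
  also have "\<dots> = (\<integral>\<theta>. \<theta> ^ (N - 1) \<partial>unif01)"
  proof (rule Bochner_Integration.integral_cong)
    fix \<theta> assume "\<theta> \<in> space unif01"
    then have \<theta>: "\<theta> \<in> {0..1}" by simp
    \<comment> \<open>All payments cancel, in the first-price case inside the winning term and in
      the all-pay case against \<open>sunk\<close>. What is left is the probability that \<theta> is
      the highest type.\<close>
    show "kernel bid \<theta> + ?p \<theta> - sunk \<theta> = \<theta> ^ (N - 1)"
    proof -
      have ratio: "weighted_deriv \<theta> / real (N - 1) =
          (case fmt of First_Price \<Rightarrow> 1 - bid \<theta> / v \<theta> | All_Pay \<Rightarrow> 1)"
        unfolding weighted_deriv_def using N by (cases fmt) auto
      show ?thesis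
        unfolding ratio kernel_eq[OF \<theta>] sunk_def by (cases fmt) (simp_all add: right_diff_distrib)
    qed
  qed simp
  finally show ?thesis by (simp only: integral_power_unif01)
qed

lemma integral_win_gain_ge:
  assumes "i < N" shows "(\<integral>\<theta>. tail_kernel profile_type \<theta> \<partial>unif01) \<le> (\<integral>\<theta>. win_gain i \<theta> \<partial>unif01)"
  unfolding integral_tail_kernel[OF profile_type_mono, symmetric]
proof (rule integral_mono_AE'[OF integrable_win_gain[OF assms] AE_I2 AE_I2])
  fix \<theta> assume "\<theta> \<in> space unif01"
  then have \<theta>: "\<theta> \<in> {0..1}" by simp
  have "{s \<in> {0..1}. profile_type s < \<theta>} = {s \<in> {0..1}. f s < bid \<theta>}"
    unfolding profile_type_def using bid_type_less_iff[OF f_nonneg \<theta>] by auto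
  then show "measure unif01 {s \<in> {0..1}. profile_type s < \<theta>} ^ (N - 1) * (weighted_deriv \<theta> / real (N - 1))
      \<le> win_gain i \<theta>"
    unfolding win_gain_def using win_prob_ge_power[OF assms f_measurable, of "bid \<theta>"] weighted_deriv_nonneg[of \<theta>] \<theta>
    by (intro mult_right_mono) auto
qed (use win_gain_bounds[OF assms] in auto)

text \<open>All-pay payments do not depend on the allocation, so equality holds there. In the
  first-price case tied types pay the same bid, hence f / v is decreasing along a tie, as the
  comparison of allocations requires.\<close>

lemma sum_integral_surplus_ge:
  "real N * ((\<integral>\<theta>. kernel f \<theta> \<partial>unif01) - (\<integral>\<theta>. sunk \<theta> \<partial>unif01)) \<le> (\<Sum>i<N. \<integral>\<theta>. surplus i \<theta> \<partial>unif01)"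
proof (cases fmt)
  case First_Price
  have "real N * (\<integral>\<theta>. \<theta> ^ (N - 1) * (f \<theta> / v \<theta>) \<partial>unif01)
      \<le> (\<Sum>i<N. \<integral>\<theta>. win_prob N f i (f \<theta>) * (f \<theta> / v \<theta>) \<partial>unif01)"
  proof (rule sum_integral_win_prob_weighted_ge[OF _ f_mono])
    fix r s :: real assume rs: "r \<in> {0..1}" "s \<in> {0..1}" "r \<le> s" "f r = f s"
    show "f s / v s \<le> f r / v r"
    \<comment> \<open>A tie with the type 0 means bidding 0, so both quotients are 0 although
      \<open>v r\<close> vanishes.\<close>
    proof (cases "r = 0")
      case False
      then have "v r \<le> v s" "0 < v r"
        using rs v_pos[of r] v_less[of r s] by (cases "r = s"; simp)+
      then show ?thesis using rs f_nonneg[of s] by (simp add: frac_le)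
    qed (use rs f_0 in simp)
  qed (use N f_measurable v_measurable f_ratio in auto)
  moreover have "(\<integral>\<theta>. kernel f \<theta> \<partial>unif01) = (\<integral>\<theta>. \<theta> ^ (N - 1) * (f \<theta> / v \<theta>) \<partial>unif01)"
    by (intro Bochner_Integration.integral_cong refl) (subst kernel_eq, auto simp: First_Price)
  moreover have "sunk = (\<lambda>_. 0)" "surplus = (\<lambda>i \<theta>. win_prob N f i (f \<theta>) * (f \<theta> / v \<theta>))"
    unfolding sunk_def[abs_def] surplus_def[abs_def] by (simp_all add: First_Price)
  ultimately show ?thesis by simp
next
  case All_Pay
  have "(\<integral>\<theta>. kernel f \<theta> \<partial>unif01) - (\<integral>\<theta>. sunk \<theta> \<partial>unif01) = (\<integral>\<theta>. kernel f \<theta> - sunk \<theta> \<partial>unif01)"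
    using integrable_pieces(1) integrable_sunk by simp
  also have "\<dots> = (\<integral>\<theta>. surplus i \<theta> \<partial>unif01)" for i
    unfolding sunk_def surplus_def
    by (intro Bochner_Integration.integral_cong refl) (subst kernel_eq, auto simp: All_Pay)
  finally show ?thesis by simp
qed

text \<open>The terms that depend on the profile are separated from those that
  \<open>integral_equilibrium\<close> evaluates.\<close>

lemma alpha_kernel_eq:
  assumes "i < N" "\<theta> \<in> {0..1}"
  shows "alpha fmt N v l i \<theta> = kernel f \<theta> - kernel bid \<theta> + tail_kernel profile_type \<theta> - tail_kernel (\<lambda>\<theta>. \<theta>) \<theta>"
  using alpha_eq[of \<theta> l i] assms f_nonneg f_0
  by (simp add: l_eq kernel_def tail_kernel_def profile_type_def algebra_simps)

lemma integrable_alpha: "i < N \<Longrightarrow> integrable unif01 (alpha fmt N v l i)"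
  using integrable_pieces
  by (subst Bochner_Integration.integrable_cong[OF refl alpha_kernel_eq])
    (auto intro!: Bochner_Integration.integrable_add Bochner_Integration.integrable_diff)

lemma integral_alpha_eq:
  assumes "i < N"
  shows "(\<integral>\<theta>. alpha fmt N v l i \<theta> \<partial>unif01)
    = (\<integral>\<theta>. kernel f \<theta> \<partial>unif01) + (\<integral>\<theta>. tail_kernel profile_type \<theta> \<partial>unif01)
      - (\<integral>\<theta>. sunk \<theta> \<partial>unif01) - 1 / real N"
proof -
  have "(\<integral>\<theta>. alpha fmt N v l i \<theta> \<partial>unif01)
      = (\<integral>\<theta>. kernel f \<theta> - kernel bid \<theta> + tail_kernel profile_type \<theta> - tail_kernel (\<lambda>\<theta>. \<theta>) \<theta> \<partial>unif01)"
    using alpha_kernel_eq[OF assms] by (intro Bochner_Integration.integral_cong) auto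
  then show ?thesis
    using integrable_pieces integral_equilibrium by simp
qed

text \<open>The constant 1 / N, summed over the buyers, matches the total winning probability under
  \<open>f\<close>. The remaining winning and payment terms are compared by
  \<open>integral_win_gain_ge\<close> and \<open>sum_integral_surplus_ge\<close>.\<close>

lemma sum_integral_alpha_le:
  "(\<Sum>i<N. \<integral>\<theta>. alpha fmt N v l i \<theta> \<partial>unif01)
    \<le> (\<Sum>i<N. \<integral>\<theta>. 1 / v \<theta> * canonical_gain fmt N v l i \<theta> \<partial>unif01)"
proof -
  let ?T = "\<integral>\<theta>. tail_kernel profile_type \<theta> \<partial>unif01"
  have "(\<Sum>i<N. \<integral>\<theta>. alpha fmt N v l i \<theta> \<partial>unif01)
      = real N * ?T - 1 + real N * ((\<integral>\<theta>. kernel f \<theta> \<partial>unif01) - (\<integral>\<theta>. sunk \<theta> \<partial>unif01))"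
    using N by (simp add: integral_alpha_eq algebra_simps)
  also have "\<dots> \<le> (\<Sum>i<N. \<integral>\<theta>. win_gain i \<theta> \<partial>unif01) - (\<Sum>i<N. \<integral>\<theta>. win_prob N f i (f \<theta>) \<partial>unif01)
      + (\<Sum>i<N. \<integral>\<theta>. surplus i \<theta> \<partial>unif01)"
  proof -
    have "real N * ?T \<le> (\<Sum>i<N. \<integral>\<theta>. win_gain i \<theta> \<partial>unif01)"
      using sum_mono[of "{..<N}" "\<lambda>_. ?T", OF integral_win_gain_ge] by simp
    moreover have "(\<Sum>i<N. \<integral>\<theta>. win_prob N f i (f \<theta>) \<partial>unif01) = 1"
      using N f_measurable by (intro sum_integral_win_prob_eq_1) auto
    ultimately show ?thesis using sum_integral_surplus_ge by simp
  qed
  also have "\<dots> = (\<Sum>i<N. \<integral>\<theta>. win_gain i \<theta> - win_prob N f i (f \<theta>) + surplus i \<theta> \<partial>unif01)"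
    using integrable_win_gain integrable_win_prob_f integrable_surplus
    by (simp add: sum.distrib sum_subtractf)
  also have "\<dots> = (\<Sum>i<N. \<integral>\<theta>. 1 / v \<theta> * canonical_gain fmt N v l i \<theta> \<partial>unif01)"
  proof (intro sum.cong refl integral_cong_AE)
    fix i assume "i \<in> {..<N}"
    then have i: "i < N" by simp
    show "(\<lambda>\<theta>. win_gain i \<theta> - win_prob N f i (f \<theta>) + surplus i \<theta>) \<in> borel_measurable unif01"
      using integrable_win_gain[OF i] integrable_win_prob_f[OF i] integrable_surplus[OF i]
      by (intro borel_measurable_integrable) auto
    show "(\<lambda>\<theta>. 1 / v \<theta> * canonical_gain fmt N v l i \<theta>) \<in> borel_measurable unif01"
      using i by (rule gain_ratio_measurable)
    show "AE \<theta> in unif01. win_gain i \<theta> - win_prob N f i (f \<theta>) + surplus i \<theta>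
        = 1 / v \<theta> * canonical_gain fmt N v l i \<theta>"
      using AE_unif01_neq[of 0] AE_space
    proof eventually_elim
      case (elim \<theta>)
      then show ?case using gain_ratio_eq[OF i, of \<theta>] by simp
    qed
  qed
  finally show ?thesis .
qed

section \<open>Sign of \<alpha> and uniqueness of the profile without gain\<close>

lemma alpha_nonneg:
  assumes "i < N" "\<theta> \<in> {0..1}" shows "0 \<le> alpha fmt N v l i \<theta>"
proof -
  have *: "0 \<le> weight \<theta> * (f \<theta> - bid \<theta>) - (weight_tail \<theta> - weight_tail (bid_type (f \<theta>)))"
  proof (cases "\<theta> = 0 \<or> f \<theta> = bid \<theta>")
    case True
    then have "f \<theta> = bid \<theta>" by (auto simp: f_0 bid_0)
    moreover have "bid_type (bid \<theta>) = \<theta>"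
      using bid_le[of \<theta> 1] assms(2) by (simp add: bid_type_def bid_inv_bid)
    ultimately show ?thesis by simp
  next
    case False
    then show ?thesis using alpha_kernel_pos[of \<theta> "f \<theta>"] f_nonneg assms(2) by auto
  qed
  have "alpha fmt N v l i \<theta> = \<theta> ^ (N - 2) * (weight \<theta> * (f \<theta> - bid \<theta>) - (weight_tail \<theta> - weight_tail (bid_type (f \<theta>))))"
    using alpha_eq[of \<theta> l i] assms f_nonneg f_0 by (simp add: l_eq)
  then show ?thesis using * assms(2) by (auto intro!: mult_nonneg_nonneg)
qed

lemma alpha_eq_0_imp:
  assumes "i < N" "0 < \<theta>" "\<theta> \<le> 1" "alpha fmt N v l i \<theta> = 0" shows "f \<theta> = bid \<theta>"
proof (rule ccontr)
  assume "f \<theta> \<noteq> bid \<theta>"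
  then have "0 < \<theta> ^ (N - 2) * (weight \<theta> * (f \<theta> - bid \<theta>) - (weight_tail \<theta> - weight_tail (bid_type (f \<theta>))))"
    using assms(2,3) f_nonneg[of \<theta>] by (intro mult_pos_pos alpha_kernel_pos) auto
  then show False
    using alpha_eq[of \<theta> l i] assms f_nonneg[of \<theta>] by (simp add: l_eq)
qed

lemma sum_integral_gain_nonneg:
  "0 \<le> (\<Sum>i<N. \<integral>\<theta>. 1 / v \<theta> * canonical_gain fmt N v l i \<theta> \<partial>unif01)"
proof -
  have "0 \<le> (\<Sum>i<N. \<integral>\<theta>. alpha fmt N v l i \<theta> \<partial>unif01)"
    using alpha_nonneg by (intro sum_nonneg integral_nonneg_AE AE_I2) auto
  then show ?thesis using sum_integral_alpha_le by simp
qed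

text \<open>The integral of \<alpha> is squeezed to 0, which gives \<open>f = bid\<close> only
  almost everywhere. Continuity extends this to every positive type, and at 0 both functions
  vanish.\<close>

lemma equilibrium_if_no_gain:
  assumes cont: "continuous_on {0<..1} f"
    and zero: "(\<Sum>i<N. \<integral>\<theta>. 1 / v \<theta> * canonical_gain fmt N v l i \<theta> \<partial>unif01) = 0"
    and \<theta>: "\<theta> \<in> {0..1}"
  shows "f \<theta> = bid \<theta>"
proof (rule ccontr)
  assume neq: "f \<theta> \<noteq> bid \<theta>"
  then have pos: "0 < \<theta>" "\<theta> \<le> 1" using \<theta> f_0 bid_0 by (auto simp: less_le)
  have nonneg: "0 \<le> (\<integral>\<theta>. alpha fmt N v l i \<theta> \<partial>unif01)" if "i < N" for i
    using alpha_nonneg[OF that] by (intro integral_nonneg_AE AE_I2) auto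
  then have "(\<integral>\<theta>. alpha fmt N v l 0 \<theta> \<partial>unif01) \<le> (\<Sum>i<N. \<integral>\<theta>. alpha fmt N v l i \<theta> \<partial>unif01)"
    using N by (intro member_le_sum) auto
  then have "(\<integral>\<theta>. alpha fmt N v l 0 \<theta> \<partial>unif01) = 0"
    using sum_integral_alpha_le zero nonneg[of 0] N by simp
  then have "AE x in unif01. alpha fmt N v l 0 x = 0"
    using N alpha_nonneg[of 0] by (subst (asm) integral_nonneg_eq_0_iff_AE[OF integrable_alpha]) auto
  then have AE: "AE x in unif01. x \<noteq> 0 \<longrightarrow> f x = bid x"
    using AE_space by eventually_elim (use alpha_eq_0_imp[of 0] N in auto)
  have "continuous_on {0<..1} (\<lambda>x. f x - bid x)"
    by (intro continuous_on_diff cont continuous_on_subset[OF bid_cont]) auto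
  then have "((\<lambda>x. f x - bid x) \<longlongrightarrow> f \<theta> - bid \<theta>) (at \<theta> within {0<..1})"
    using pos by (auto simp: continuous_on_def)
  then have "\<forall>\<^sub>F x in at \<theta> within {0<..1}. f x - bid x \<noteq> 0"
    by (rule tendsto_imp_eventually_ne) (use neq in simp)
  then obtain d where d: "0 < d" "\<And>x. x \<in> {0<..1} \<Longrightarrow> x \<noteq> \<theta> \<Longrightarrow> dist x \<theta> < d \<Longrightarrow> f x \<noteq> bid x"
    unfolding eventually_at by auto
  \<comment> \<open>An interval to the left of \<theta> also works for \<theta> = 1. The first entry
    keeps it among positive types, the second within distance \<open>d\<close>.\<close>
  define a where "a = max (\<theta> / 2) (\<theta> - d / 2)"
  have a: "0 < a" "a < \<theta>" using pos d(1) by (auto simp: a_def)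
  have "AE x in unif01. x \<notin> {a<..<\<theta>}"
    using AE
  proof eventually_elim
    case (elim x)
    show ?case
    proof
      assume x: "x \<in> {a<..<\<theta>}"
      then have "dist x \<theta> < d" using d(1) by (auto simp: a_def dist_real_def)
      then show False using d(2)[of x] elim x a pos by auto
    qed
  qed
  moreover have "{a<..<\<theta>} \<in> sets unif01"
    using a pos by (intro sets_unif01_subset) auto
  ultimately have "emeasure unif01 {a<..<\<theta>} = 0"
    by (simp only: AE_iff_null_sets[symmetric] null_setsD1)
  then show False
    using a pos by (subst (asm) emeasure_restrict_space) auto
qed

end

section \<open>Equilibria\<close>

lemma space_borel_of_topology: "space (borel_of_topology T) = topspace T"
  unfolding borel_of_topology_def by (intro space_measure_of) (auto dest: openin_subset)

context quantile_auction_format begin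

lemma symmetric_profileI:
  assumes "l \<in> symmetric_C1_profiles N v bmax M" "1 \<le> M"
  shows "symmetric_profile N v fmt l (l 0) M"
proof -
  have N0: "0 < N" using N by simp
  have ran: "l 0 \<in> {0..1} \<rightarrow>\<^sub>E {0..bmax}"
    using assms(1) N0 unfolding symmetric_C1_profiles_def by blast
  show ?thesis
  proof
    show "l j = l 0" if "j < N" for j
      using assms(1) that N0 unfolding symmetric_C1_profiles_def by blast
    show "mono_on {0..1} (l 0)" "\<And>x. x \<in> {0..1} \<Longrightarrow> l 0 x \<le> M * v x"
      using assms(1) N0 unfolding symmetric_C1_profiles_def by blast+
    show "0 \<le> l 0 x" if "x \<in> {0..1}" for x
      using PiE_mem[OF ran that] by simp
  qed (rule assms(2))
qed

lemma continuous_on_profile: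
  assumes "l \<in> symmetric_C1_profiles N v bmax M" shows "continuous_on {0<..1} (l 0)"
proof -
  have "C1_within {0<..1} (l 0)"
    using assms order_less_le_trans[OF zero_less_numeral N] unfolding symmetric_C1_profiles_def by blast
  then show ?thesis unfolding C1_within_def using DERIV_continuous_on by blast
qed

lemma lp_feasible_alpha:
  assumes "\<Lambda> \<subseteq> symmetric_C1_profiles N v bmax M" "1 \<le> M"
  shows "lp_feasible fmt N v \<Lambda> (alpha fmt N v) (\<lambda>_. 1) 0"
  unfolding lp_feasible_def
proof (intro conjI ballI)
  fix l assume "l \<in> \<Lambda>"
  then interpret symmetric_profile N v fmt l "l 0" M
    using assms by (intro symmetric_profileI) auto
  show "\<forall>i<N. integrable unif01 (\<lambda>\<theta>. 1 / v \<theta> * canonical_gain fmt N v l i \<theta>) \<and>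
      integrable unif01 (alpha fmt N v l i)"
    using integrable_gain_ratio integrable_alpha by blast
  show "(\<Sum>i<N. \<integral>\<theta>. alpha fmt N v l i \<theta> \<partial>unif01)
      \<le> 0 + (\<Sum>i<N. \<integral>\<theta>. 1 / v \<theta> * canonical_gain fmt N v l i \<theta> \<partial>unif01)"
    using sum_integral_alpha_le by simp
qed simp

text \<open>Joint measurability in profile, type and bid allows the type-dependent bid
  \<open>bid \<theta>\<close> to be substituted; it is a legal bid since it is at most
  \<open>v 1\<close>.\<close>

lemma canonical_gain_measurable:
  assumes "deviation_measurable fmt N v bmax T" "sets \<sigma> = sets (borel_of_topology T)"
    and "v 1 \<le> bmax" "i < N"
  shows "(\<lambda>(l, \<theta>). canonical_gain fmt N v l i \<theta>) \<in> borel_measurable (\<sigma> \<Otimes>\<^sub>M unif01)"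
proof -
  let ?R = "restrict_space borel {0..1 :: real}" and ?B = "restrict_space borel {0..bmax}"
  have \<theta>: "snd \<in> \<sigma> \<Otimes>\<^sub>M unif01 \<rightarrow>\<^sub>M ?R"
    using measurable_snd[of \<sigma> unif01] by (simp only: measurable_cong_sets[OF refl sets_unif01])
  have l: "fst \<in> \<sigma> \<Otimes>\<^sub>M unif01 \<rightarrow>\<^sub>M borel_of_topology T"
    using measurable_fst[of \<sigma> unif01] by (simp only: measurable_cong_sets[OF refl assms(2)])
  have "bid \<theta> \<in> {0..bmax}" if "\<theta> \<in> {0..1}" for \<theta>
    using bid_nonneg[of \<theta>] bid_le[of \<theta> 1] bid_le_v[of 1] assms(3) that by auto
  then have "bid \<in> unif01 \<rightarrow>\<^sub>M ?B"
    using bid_measurable by (intro measurable_restrict_space2) auto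
  from measurable_compose[OF measurable_snd this]
  have b: "(\<lambda>x. bid (snd x)) \<in> \<sigma> \<Otimes>\<^sub>M unif01 \<rightarrow>\<^sub>M ?B" .
  have D: "(\<lambda>(l, \<theta>, b'). dev_utility fmt N v b' l i \<theta> - exp_utility fmt N v l i \<theta>)
      \<in> borel_measurable (borel_of_topology T \<Otimes>\<^sub>M (?R \<Otimes>\<^sub>M ?B))"
    using assms(1,4) unfolding deviation_measurable_def by blast
  from measurable_compose[OF measurable_Pair[OF l measurable_Pair[OF \<theta> b]] D]
  show ?thesis by (simp add: canonical_gain_def case_prod_unfold bid_def)
qed

text \<open>For a fixed type the deviation to \<beta> is a constant bid, so the equilibrium
  condition applies type by type.\<close>

lemma continuous_BCCE_canonical_gain_nonpos:
  assumes "continuous_BCCE fmt N v bmax T \<sigma>" "v 1 \<le> bmax" "i < N" "\<theta> \<in> {0..1}"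
  shows "(\<integral>l. canonical_gain fmt N v l i \<theta> \<partial>\<sigma>) \<le> 0"
proof -
  have "bid \<theta> \<in> {0..bmax}"
    using bid_nonneg[of \<theta>] bid_le[of \<theta> 1] bid_le_v[of 1] assms(2,4) by auto
  then show ?thesis
    using assms(1,3,4) unfolding continuous_BCCE_def canonical_gain_def bid_def by blast
qed

lemma continuous_BCCE_measure_equilibrium:
  assumes \<Lambda>: "\<Lambda> \<subseteq> symmetric_C1_profiles N v bmax M" "1 \<le> M" and bmax: "v 1 \<le> bmax"
    and T: "topspace T = \<Lambda>" and BCCE: "continuous_BCCE fmt N v bmax T \<sigma>"
    and interchange: "interchange_condition fmt N v \<sigma> (\<lambda>_. 1)"
  shows "measure \<sigma> {l \<in> \<Lambda>. \<forall>i<N. \<forall>\<theta>\<in>{0..1}. l i \<theta> = canonical_bid fmt N v \<theta>} = 1"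
proof -
  define J where "J l = (\<Sum>i<N. \<integral>\<theta>. 1 / v \<theta> * canonical_gain fmt N v l i \<theta> \<partial>unif01)" for l
  have sets: "sets \<sigma> = sets (borel_of_topology T)" and dev: "deviation_measurable fmt N v bmax T"
    and prob: "prob_space \<sigma>"
    using BCCE by (auto simp: continuous_BCCE_def)
  interpret prob_space \<sigma> by (rule prob)
  interpret U: prob_space unif01 by (rule prob_space_unif01)
  have space: "space \<sigma> = \<Lambda>"
    using sets_eq_imp_space_eq[OF sets] T by (simp add: space_borel_of_topology)
  have profile: "symmetric_profile N v fmt l (l 0) M" if "l \<in> \<Lambda>" for l
    using \<Lambda> that by (intro symmetric_profileI) auto
  have J_meas: "J \<in> borel_measurable \<sigma>"
    unfolding J_def[abs_def]
  proof (intro borel_measurable_sum U.borel_measurable_lebesgue_integral)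
    fix i assume "i \<in> {..<N}"
    then have "(\<lambda>(l, \<theta>). canonical_gain fmt N v l i \<theta>) \<in> borel_measurable (\<sigma> \<Otimes>\<^sub>M unif01)"
      using canonical_gain_measurable[OF dev sets bmax] by simp
    moreover have "(\<lambda>x. v (snd x)) \<in> borel_measurable (\<sigma> \<Otimes>\<^sub>M unif01)"
      using measurable_compose[OF measurable_snd v_measurable] .
    ultimately show "(\<lambda>(l, \<theta>). 1 / v \<theta> * canonical_gain fmt N v l i \<theta>)
        \<in> borel_measurable (\<sigma> \<Otimes>\<^sub>M unif01)"
      unfolding case_prod_unfold by (intro borel_measurable_times borel_measurable_divide) auto
  qed
  have J_nonneg: "0 \<le> J l" if "l \<in> \<Lambda>" for l
    unfolding J_def by (rule symmetric_profile.sum_integral_gain_nonneg[OF profile[OF that]])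
  have J_le: "J l \<le> (\<Sum>i<N. 2 + M)" if "l \<in> \<Lambda>" for l
    unfolding J_def
  proof (rule sum_mono)
    fix i assume "i \<in> {..<N}"
    then have i: "i < N" by simp
    interpret symmetric_profile N v fmt l "l 0" M by (rule profile[OF that])
    show "(\<integral>\<theta>. 1 / v \<theta> * canonical_gain fmt N v l i \<theta> \<partial>unif01) \<le> 2 + M"
      by (intro U.integral_le_const integrable_gain_ratio[OF i] AE_I2 abs_le_D1[OF gain_ratio_bound[OF i]])
        simp
  qed
  \<comment> \<open>Without integrability a zero integral would say nothing, as it is also the
    default value. The uniform bound on the gain settles this.\<close>
  have J_int: "integrable \<sigma> J"
    using J_nonneg J_le by (intro integrable_const_bound[OF AE_I2 J_meas]) (auto simp: space)
  have "(\<integral>l. J l \<partial>\<sigma>)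
      = (\<Sum>i<N. \<integral>\<theta>. 1 / v \<theta> * (\<integral>l. canonical_gain fmt N v l i \<theta> \<partial>\<sigma>) \<partial>unif01)"
    using interchange unfolding interchange_condition_def J_def .
  also have "\<dots> \<le> 0"
  proof (rule sum_nonpos)
    fix i assume "i \<in> {..<N}"
    \<comment> \<open>The sign is passed through the negated integrand because nonnegativity of an
      integral holds without first establishing integrability in \<theta>.\<close>
    then have "0 \<le> - (1 / v \<theta> * (\<integral>l. canonical_gain fmt N v l i \<theta> \<partial>\<sigma>))" if "\<theta> \<in> {0..1}" for \<theta>
      using continuous_BCCE_canonical_gain_nonpos[OF BCCE bmax _ that] v_nonneg[of \<theta>] that
      by (simp add: divide_nonpos_nonneg)
    then have "0 \<le> (\<integral>\<theta>. - (1 / v \<theta> * (\<integral>l. canonical_gain fmt N v l i \<theta> \<partial>\<sigma>)) \<partial>unif01)"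
      by (intro integral_nonneg_AE AE_I2) auto
    then show "(\<integral>\<theta>. 1 / v \<theta> * (\<integral>l. canonical_gain fmt N v l i \<theta> \<partial>\<sigma>) \<partial>unif01) \<le> 0"
      by simp
  qed
  finally have "(\<integral>l. J l \<partial>\<sigma>) \<le> 0" .
  moreover have "0 \<le> (\<integral>l. J l \<partial>\<sigma>)"
    using J_nonneg by (intro integral_nonneg_AE AE_I2) (simp add: space)
  ultimately have "(\<integral>l. J l \<partial>\<sigma>) = 0" by simp
  then have AE: "AE l in \<sigma>. J l = 0"
    using J_nonneg by (subst (asm) integral_nonneg_eq_0_iff_AE[OF J_int]) (auto simp: space)
  \<comment> \<open>An exact equality of sets, not one up to null sets: it makes the equilibrium
    event measurable through \<open>J\<close>, whatever the topology on \<Lambda>.\<close>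
  have "{l \<in> \<Lambda>. \<forall>i<N. \<forall>\<theta>\<in>{0..1}. l i \<theta> = canonical_bid fmt N v \<theta>} = {l \<in> space \<sigma>. J l = 0}"
  proof (intro set_eqI iffI)
    fix l assume "l \<in> {l \<in> \<Lambda>. \<forall>i<N. \<forall>\<theta>\<in>{0..1}. l i \<theta> = canonical_bid fmt N v \<theta>}"
    then have l: "l \<in> \<Lambda>" and eq: "\<forall>i<N. \<forall>\<theta>\<in>{0..1}. l i \<theta> = canonical_bid fmt N v \<theta>"
      by blast+
    have "canonical_gain fmt N v l i \<theta> = 0" if "i < N" "\<theta> \<in> {0..1}" for i \<theta>
      using eq that unfolding canonical_gain_def exp_utility_eq_dev_utility by simp
    then have "(\<integral>\<theta>. 1 / v \<theta> * canonical_gain fmt N v l i \<theta> \<partial>unif01) = (\<integral>\<theta>. 0 \<partial>unif01)" if "i < N" for i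
      using that by (intro Bochner_Integration.integral_cong) auto
    then show "l \<in> {l \<in> space \<sigma>. J l = 0}" using l by (simp add: J_def space)
  next
    fix l assume "l \<in> {l \<in> space \<sigma>. J l = 0}"
    then have l: "l \<in> \<Lambda>" and J: "J l = 0" by (auto simp: space)
    interpret symmetric_profile N v fmt l "l 0" M by (rule profile[OF l])
    have "l 0 \<theta> = bid \<theta>" if "\<theta> \<in> {0..1}" for \<theta>
      using equilibrium_if_no_gain[OF continuous_on_profile[of l bmax M] J[unfolded J_def] that] l \<Lambda>(1)
      by blast
    then have "l i \<theta> = canonical_bid fmt N v \<theta>" if "i < N" "\<theta> \<in> {0..1}" for i \<theta>
      unfolding l_eq[OF that(1)] bid_def[symmetric] using that(2) .
    then show "l \<in> {l \<in> \<Lambda>. \<forall>i<N. \<forall>\<theta>\<in>{0..1}. l i \<theta> = canonical_bid fmt N v \<theta>}"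
      using l by blast
  qed
  moreover have "prob {l \<in> space \<sigma>. J l = 0} = 1"
    using AE J_meas by (subst prob_Collect_eq_1) auto
  ultimately show ?thesis by simp
qed

end

theorem theorem4p9:
  fixes N :: nat and F v :: "real \<Rightarrow> real" and bmax M :: real and \<Lambda> :: "profile set"
  assumes "N \<ge> 2"
    and "quantile_prior F v"
    and "v 1 \<le> bmax"
    and "M \<ge> 1"
    and "\<Lambda> \<subseteq> symmetric_C1_profiles N v bmax M"
    and "strict_mono_on {0..1} v"
    and "v differentiable_on {0..1}"
  shows "(lp_feasible All_Pay N v \<Lambda> (alpha All_Pay N v) (\<lambda>_. 1) 0
            \<and> lp_objective (\<lambda>_. 1) 0 = 0)
         \<and> (strictly_convex_on {0..1} v \<longrightarrow>
              lp_feasible First_Price N v \<Lambda> (alpha First_Price N v) (\<lambda>_. 1) 0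
                \<and> lp_objective (\<lambda>_. 1) 0 = 0)
         \<and> (\<forall>fmt T \<sigma>.
              (fmt = First_Price \<longrightarrow> strictly_convex_on {0..1} v) \<longrightarrow>
              topspace T = \<Lambda> \<longrightarrow>
              continuous_BCCE fmt N v bmax T \<sigma> \<longrightarrow>
              interchange_condition fmt N v \<sigma> (\<lambda>_. 1) \<longrightarrow>
              measure \<sigma> {l \<in> \<Lambda>. \<forall>i<N. \<forall>\<theta>\<in>{0..1}. l i \<theta> = canonical_bid fmt N v \<theta>} = 1)"
proof -
  have "quantile_auction N v"
    using assms(1,2,6) quantile_prior_0[OF assms(2)]
    unfolding quantile_prior_def by (intro quantile_auction.intro) blast+
  then have format: "quantile_auction_format N v fmt"
    if "fmt = First_Price \<longrightarrow> strictly_convex_on {0..1} v" for fmt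
    using that by (intro quantile_auction_format.intro quantile_auction_format_axioms.intro) blast+
  note feasible = quantile_auction_format.lp_feasible_alpha[OF format assms(5,4)]
  note equilibrium = quantile_auction_format.continuous_BCCE_measure_equilibrium[OF format assms(5,4,3)]
  have "lp_objective (\<lambda>_. 1) 0 = 0"
    by (rule lp_objective_def)
  moreover have "lp_feasible All_Pay N v \<Lambda> (alpha All_Pay N v) (\<lambda>_. 1) 0"
    by (rule feasible) simp
  moreover have "lp_feasible First_Price N v \<Lambda> (alpha First_Price N v) (\<lambda>_. 1) 0"
    if "strictly_convex_on {0..1} v"
    by (rule feasible) (use that in blast)
  ultimately show ?thesis
    using equilibrium by blast
qed

end
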